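(* Let $m\ge n$, let $\xi:\mathbb R^n\to\mathcal M_{m\times n}$ be a solution of the $G_{m,n}$-system, and let $E(x,\lambda)$ be a frame of $\xi$ that is holomorphic for $\lambda\in\mathbb C$. Let $s\in\mathbb R$, $s\neq0$, let $W\in\mathbb R^m$, $Z\in\mathbb R^n$ be unit vectors, $\pi$ the Hermitian projection of $\mathbb C^{n+m}$ onto $\mathbb C\begin{pmatrix}W\\ iZ\end{pmatrix}$, and $g_{s,\pi}$ the associated rational map. Define $$\begin{pmatrix}\tilde W\\ i\tilde Z\end{pmatrix}(x)=E(x,-is)^{-1}\begin{pmatrix}W\\ iZ\end{pmatrix},$$ let $\tilde\pi(x)$ be the Hermitian projection onto $\mathbb C\begin{pmatrix}\tilde W\\ i\tilde Z\end{pmatrix}(x)$, $\hat W=\tilde W/\|\tilde W\|$, $\hat Z=\tilde Z/\|\tilde Z\|$, and $$\tilde E(x,\lambda)=g_{s,\pi}(\lambda)E(x,\lambda)g_{s,\tilde\pi(x)}(\lambda)^{-1},\qquad \tilde\xi=\xi-2s(\hat W\hat Z^t)_*,$$ where $(\eta_* )_{ij}=\eta_{ij}$ if $i\ne j$ and $(\eta_* )_{ii}=0$ for $1\le i\le n$. Then $\tilde\xi$ is a solution of the $G_{m,n}$-system, $\tilde E$ is a frame for $\tilde\xi$, and $\tilde E(x,\lambda)$ is holomorphic in $\lambda\in\mathbb C$.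
   Context: $\mathcal M_{m\times n}$: real $m\times n$ matrices. $D_i\in\mathcal M_{m\times n}$ has a single non-zero entry $1$ at $(i,i)$. A map $\xi=(\xi_{ij}):\mathbb R^n\to\mathcal M_{m\times n}$ with $\xi_{ii}=0$ for $1\le i\le n$ is a solution of the $G_{m,n}$-system if $$\theta_\lambda=\sum_{i=1}^n\left\{\lambda\begin{pmatrix}0&-D_i\\ D_i^t&0\end{pmatrix}+\begin{pmatrix}D_i\xi^t-\xi D_i^t&0\\ 0&-\xi^tD_i+D_i^t\xi\end{pmatrix}\right\}dx_i$$ is flat ($d\theta_\lambda+\theta_\lambda\wedge\theta_\lambda=0$) for all $\lambda\in\mathbb C$. A frame of $\xi$ is a smooth map $E(x,\lambda)\in GL(m+n,\mathbb C)$ with $E^{-1}dE=\theta_\lambda$ ($d$ in $x$) satisfying the $G_{m,n}$-reality condition: $\overline{E(x,\bar\lambda)}=E(x,\lambda)$, $I_{m,n}E(x,\lambda)I_{m,n}^{-1}=E(x,-\lambda)$, $E(x,\lambda)E(x,\lambda)^t=I$, where $I_{m,n}=\mathrm{diag}(I_m,-I_n)$. The rational map $g_{s,\pi}$ is $$g_{s,\pi}(\lambda)=\Big(\pi+\tfrac{\lambda-is}{\lambda+is}(I-\pi)\Big)\Big(\bar\pi+\tfrac{\lambda+is}{\lambda-is}(I-\bar\pi)\Big).$$ (One has that $\tilde W(x),\tilde Z(x)$ are real with $\|\tilde W\|=\|\tilde Z\|$, and $g_{s,\tilde\pi(x)}$ is defined by the same formula.) *)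

theory Defs
  imports "HOL-Analysis.Analysis"
begin

text \<open>
  Matrices in \<open>M\<^sub>m\<^sub>\<times>\<^sub>n\<close> have type \<open>real^'n^'m\<close>, with \<open>m = CARD('m)\<close> and \<open>n = CARD('n)\<close>; square
  matrices of size \<open>m + n\<close> are indexed by \<open>'m + 'n\<close>.  The standing assumption \<open>m \<ge> n\<close> and the
  positions \<open>(i, i)\<close> of an \<open>m \<times> n\<close> matrix are given by an injection \<open>\<iota> :: 'n \<Rightarrow> 'm\<close>: the entry
  called \<open>(i, i)\<close> is the one in row \<open>\<iota> i\<close> and column \<open>i\<close>.  Such an injection exists iff
  \<open>m \<ge> n\<close>; the usual convention is the case where the indices are numbered and \<open>\<iota>\<close> is the
  inclusion of \<open>{1..n}\<close> into \<open>{1..m}\<close>.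
\<close>

section \<open>Smooth maps and matrix-valued 1-forms\<close>

text \<open>Class \<open>C\<^sup>k\<close> via iterated directional derivatives (for finite-dimensional domains).\<close>

primrec C_diff :: "nat \<Rightarrow> ('a::real_normed_vector \<Rightarrow> 'b::real_normed_vector) \<Rightarrow> bool" where
  "C_diff 0 f \<longleftrightarrow> continuous_on UNIV f"
| "C_diff (Suc k) f \<longleftrightarrow>
     (\<forall>x. f differentiable (at x)) \<and> (\<forall>v. C_diff k (\<lambda>x. frechet_derivative f (at x) v))"

definition smooth :: "('a::real_normed_vector \<Rightarrow> 'b::real_normed_vector) \<Rightarrow> bool" where
  "smooth f \<longleftrightarrow> (\<forall>k. C_diff k f)"

text \<open>A 1-form \<open>\<theta>\<close> is given by its values \<open>\<theta> x v\<close> at a point \<open>x\<close> and a tangent vector \<open>v\<close>.\<close>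

definition ext_deriv ::
  "('a::real_normed_vector \<Rightarrow> 'a \<Rightarrow> 'b::real_normed_vector) \<Rightarrow> 'a \<Rightarrow> 'a \<Rightarrow> 'a \<Rightarrow> 'b" where
  "ext_deriv \<theta> x u v =
     frechet_derivative (\<lambda>y. \<theta> y v) (at x) u - frechet_derivative (\<lambda>y. \<theta> y u) (at x) v"

definition wedge ::
  "('a \<Rightarrow> 'a \<Rightarrow> complex^'k^'k) \<Rightarrow> ('a \<Rightarrow> 'a \<Rightarrow> complex^'k^'k) \<Rightarrow> 'a \<Rightarrow> 'a \<Rightarrow> 'a \<Rightarrow> complex^'k^'k"
  where "wedge \<theta> \<eta> x u v = \<theta> x u ** \<eta> x v - \<theta> x v ** \<eta> x u"

definition flat :: "('a::real_normed_vector \<Rightarrow> 'a \<Rightarrow> complex^'k^'k) \<Rightarrow> bool" where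
  "flat \<theta> \<longleftrightarrow> (\<forall>x u v. ext_deriv \<theta> x u v + wedge \<theta> \<theta> x u v = 0)"


section \<open>The \<open>G\<^sub>m\<^sub>,\<^sub>n\<close>-system\<close>

text \<open>The spectral parameter is written \<open>z\<close>.\<close>

definition mscale :: "complex \<Rightarrow> complex^'n^'m \<Rightarrow> complex^'n^'m" (infixr "\<cdot>\<^sub>m" 75) where
  "c \<cdot>\<^sub>m A = map_matrix (\<lambda>a. c * a) A"

definition block :: "'a^'m^'m \<Rightarrow> 'a^'n^'m \<Rightarrow> 'a^'m^'n \<Rightarrow> 'a^'n^'n \<Rightarrow> 'a^('m + 'n)^('m + 'n)" where
  "block A B C D = (\<chi> r c.
     case (r, c) of
       (Inl i, Inl j) \<Rightarrow> A $ i $ j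
     | (Inl i, Inr j) \<Rightarrow> B $ i $ j
     | (Inr i, Inl j) \<Rightarrow> C $ i $ j
     | (Inr i, Inr j) \<Rightarrow> D $ i $ j)"

definition Dmat :: "('n \<Rightarrow> 'm) \<Rightarrow> 'n \<Rightarrow> complex^'n^'m" where
  "Dmat \<iota> i = (\<chi> k l. if k = \<iota> i \<and> l = i then 1 else 0)"

definition theta_coeff ::
  "('n \<Rightarrow> 'm) \<Rightarrow> complex^'n^'m \<Rightarrow> complex \<Rightarrow> 'n \<Rightarrow> complex^('m::finite + 'n::finite)^('m + 'n)" where
  "theta_coeff \<iota> X z i = (let D = Dmat \<iota> i in
     z \<cdot>\<^sub>m block 0 (- D) (transpose D) 0 +
     block (D ** transpose X - X ** transpose D) 0
           0 (- (transpose X ** D) + transpose D ** X))"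

text \<open>\<open>dx\<^sub>i v = v $ i\<close>.\<close>

definition theta ::
  "('n \<Rightarrow> 'm) \<Rightarrow> (real^'n \<Rightarrow> real^'n^'m) \<Rightarrow> complex \<Rightarrow> real^'n \<Rightarrow> real^'n \<Rightarrow> complex^('m::finite + 'n::finite)^('m + 'n)"
  where
  "theta \<iota> \<xi> z x v =
     (\<Sum>i\<in>UNIV. (v $ i) *\<^sub>R theta_coeff \<iota> (map_matrix complex_of_real (\<xi> x)) z i)"

definition Gmn_solution :: "('n \<Rightarrow> 'm) \<Rightarrow> (real^'n \<Rightarrow> real^'n^'m) \<Rightarrow> bool" where
  "Gmn_solution \<iota> \<xi> \<longleftrightarrow>
     smooth \<xi> \<and> (\<forall>x i. \<xi> x $ \<iota> i $ i = 0) \<and> (\<forall>z. flat (theta \<iota> \<xi> z))"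

definition Imn :: "complex^('m::finite + 'n::finite)^('m + 'n)" where
  "Imn = block (mat 1) 0 0 (- mat 1)"

definition Gmn_reality :: "('a \<Rightarrow> complex \<Rightarrow> complex^('m::finite + 'n::finite)^('m + 'n)) \<Rightarrow> bool" where
  "Gmn_reality E \<longleftrightarrow> (\<forall>x z.
     map_matrix cnj (E x (cnj z)) = E x z \<and>
     Imn ** E x z ** matrix_inv Imn = E x (- z) \<and>
     E x z ** transpose (E x z) = mat 1)"

definition Gmn_frame ::
  "('n \<Rightarrow> 'm) \<Rightarrow> (real^'n \<Rightarrow> real^'n^'m) \<Rightarrow> (real^'n \<Rightarrow> complex \<Rightarrow> complex^('m::finite + 'n::finite)^('m + 'n)) \<Rightarrow> bool"
  where
  "Gmn_frame \<iota> \<xi> E \<longleftrightarrow>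
     smooth (\<lambda>(x, z). E x z) \<and>
     (\<forall>x z. invertible (E x z)) \<and>
     (\<forall>x z v. matrix_inv (E x z) ** frechet_derivative (\<lambda>y. E y z) (at x) v = theta \<iota> \<xi> z x v) \<and>
     Gmn_reality E"

definition holomorphic_in_param :: "('a \<Rightarrow> complex \<Rightarrow> complex^'k^'l) \<Rightarrow> bool" where
  "holomorphic_in_param E \<longleftrightarrow> (\<forall>x i j. (\<lambda>z. E x z $ i $ j) holomorphic_on UNIV)"


section \<open>The dressing action\<close>

definition hermitian_projection_onto :: "(complex^'k) set \<Rightarrow> complex^'k^'k \<Rightarrow> bool" where
  "hermitian_projection_onto S P \<longleftrightarrow>
     P ** P = P \<and> map_matrix cnj (transpose P) = P \<and> range (\<lambda>v. P *v v) = S"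

definition W_iZ :: "real^'m \<Rightarrow> real^'n \<Rightarrow> complex^('m + 'n)" where
  "W_iZ W Z = (\<chi> r. case r of Inl i \<Rightarrow> of_real (W $ i) | Inr j \<Rightarrow> \<i> * of_real (Z $ j))"

definition complex_line :: "complex^'k \<Rightarrow> (complex^'k) set" where
  "complex_line v = range (\<lambda>c. c *s v)"

text \<open>Only meaningful for \<open>z \<noteq> \<plusminus>\<i>s\<close>.\<close>

definition g_map :: "real \<Rightarrow> complex^'k^'k \<Rightarrow> complex \<Rightarrow> complex^'k^'k" where
  "g_map s P z =
     (let a = \<i> * of_real s; Q = map_matrix cnj P in
      (P + ((z - a) / (z + a)) \<cdot>\<^sub>m (mat 1 - P)) ** (Q + ((z + a) / (z - a)) \<cdot>\<^sub>m (mat 1 - Q)))"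

definition outer :: "real^'m \<Rightarrow> real^'n \<Rightarrow> real^'n^'m" where
  "outer W Z = (\<chi> i j. W $ i * Z $ j)"

definition off_diag :: "('n \<Rightarrow> 'm) \<Rightarrow> real^'n^'m \<Rightarrow> real^'n^'m" where
  "off_diag \<iota> \<eta> = (\<chi> i j. if i = \<iota> j then 0 else \<eta> $ i $ j)"

end

theory Submission
  imports Defs "HOL-Complex_Analysis.Cauchy_Integral_Formula"
begin

text \<open>
  Write \<open>a = \<i>s\<close>.  Both factors of the simple element combine to
  \<open>g = I + 2a/(z - a) \<pi> - 2a/(z + a) \<pi>\<^sup>t\<close>, an orthogonal matrix away from \<open>z = \<plusminus>a\<close>, since \<open>\<pi>\<close> projects
  onto an isotropic line and \<open>\<pi>\<^sup>t\<close> is its complex conjugate.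

  With \<open>\<theta>\<^sub>z = z A + B\<close> and \<open>B = [A, V]\<close>, where \<open>A\<close>, \<open>B\<close>, \<open>V\<close> are skew, the dressed projection \<open>P\<close>
  satisfies \<open>dP = [P, B] + a (A P + P A) - 2a P A P\<close>.  For \<open>z \<noteq> \<plusminus>a\<close> this turns
  \<open>dE = E \<theta>\<close> into the same equation for the dressed frame, with \<open>V\<close> replaced by
  \<open>V - 2a (P - P\<^sup>t)\<close>; the diagonal of the correction commutes with \<open>A\<close> and may be dropped.

  The poles at \<open>\<plusminus>a\<close> cancel because \<open>E(x, a)\<close> maps the dressed line to the original one and because
  \<open>E\<^sub>z E\<^sup>-\<^sup>1\<close> is skew.  Writing the dressed frame through first and second difference quotients of \<open>E\<close>
  at \<open>\<plusminus>a\<close>, which are integrals and hence smooth, shows that it extends smoothly in \<open>(x, z)\<close>; all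
  identities persist at \<open>z = \<plusminus>a\<close> by continuity, and flatness follows from the symmetry of second
  derivatives.
\<close>

section \<open>Calculus of smooth maps\<close>

text \<open>\<open>frechet_derivative\<close> is a chosen operator; uniqueness of the derivative
  lets the inductions below work with an explicit formula instead.\<close>

lemma C_diff_SucI:
  assumes "\<And>x. (f has_derivative f' x) (at x)" "\<And>v. C_diff k (\<lambda>x. f' x v)"
  shows "C_diff (Suc k) f"
proof -
  have "frechet_derivative f (at x) = f' x" for x
    using assms(1) frechet_derivative_at by metis
  then show ?thesis using assms by (auto simp: differentiable_def)
qed

lemma C_diff_SucD:
  assumes "C_diff (Suc k) f"
  shows "(f has_derivative frechet_derivative f (at x)) (at x)"
    and "C_diff k (\<lambda>x. frechet_derivative f (at x) v)"
  using assms by (auto simp: frechet_derivative_works)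

lemma C_diff_imp_continuous_on: "C_diff k f \<Longrightarrow> continuous_on UNIV f"
proof (cases k)
  case (Suc j)
  assume "C_diff k f"
  then have "f differentiable_on UNIV" using Suc by (auto simp: differentiable_on_def)
  then show ?thesis by (rule differentiable_imp_continuous_on)
qed auto

lemma C_diff_le: "C_diff k f \<Longrightarrow> j \<le> k \<Longrightarrow> C_diff j f"
proof (induction j arbitrary: k f)
  case 0
  then show ?case using C_diff_imp_continuous_on by auto
next
  case (Suc j)
  then obtain k' where "k = Suc k'" "j \<le> k'" by (cases k) auto
  then show ?case using Suc by auto
qed

lemma C_diff_const [simp]: "C_diff k (\<lambda>x. c)"
  by (induction k arbitrary: c) auto

lemma C_diff_bounded_linear_compose:
  assumes "bounded_linear h"
  shows "C_diff k f \<Longrightarrow> C_diff k (\<lambda>x. h (f x))"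
proof (induction k arbitrary: f)
  case 0
  then show ?case using bounded_linear.continuous_on[OF assms] by auto
next
  case (Suc k)
  show ?case
    by (rule C_diff_SucI[OF bounded_linear.has_derivative[OF assms C_diff_SucD(1)[OF Suc.prems]]])
       (rule Suc.IH[OF C_diff_SucD(2)[OF Suc.prems]])
qed

lemma C_diff_ident: "C_diff k (\<lambda>x. x)"
proof (cases k)
  case (Suc j)
  then show ?thesis by (auto intro!: C_diff_SucI[where f'="\<lambda>x v. v"] simp del: C_diff.simps)
qed auto

lemma C_diff_bounded_linear: "bounded_linear h \<Longrightarrow> C_diff k h"
  using C_diff_bounded_linear_compose[OF _ C_diff_ident] .

lemma C_diff_add: "C_diff k f \<Longrightarrow> C_diff k g \<Longrightarrow> C_diff k (\<lambda>x. f x + g x)"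
proof (induction k arbitrary: f g)
  case 0
  then show ?case by (auto intro: continuous_intros)
next
  case (Suc k)
  show ?case
    by (rule C_diff_SucI[where f'="\<lambda>x v. frechet_derivative f (at x) v + frechet_derivative g (at x) v"])
       (use Suc C_diff_SucD[OF Suc.prems(1)] C_diff_SucD[OF Suc.prems(2)] in
         \<open>auto intro: has_derivative_add\<close>)
qed

lemma C_diff_sum: "(\<And>i. i \<in> I \<Longrightarrow> C_diff k (f i)) \<Longrightarrow> C_diff k (\<lambda>x. \<Sum>i\<in>I. f i x)"
  by (induction I rule: infinite_finite_induct) (auto intro: C_diff_add)

text \<open>By the product rule each directional derivative is a sum of two products of
  \<open>C_diff k\<close> maps, so the induction keeps both factors arbitrary.\<close>

lemma C_diff_bounded_bilinear:
  assumes "bounded_bilinear h"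
  shows "C_diff k f \<Longrightarrow> C_diff k g \<Longrightarrow> C_diff k (\<lambda>x. h (f x) (g x))"
proof (induction k arbitrary: f g)
  case 0
  then show ?case using bounded_bilinear.continuous_on[OF assms] by auto
next
  case (Suc k)
  have "C_diff k f" "C_diff k g"
    using Suc.prems C_diff_le[OF _ le_SucI[OF order_refl]] by auto
  show ?case
    by (rule C_diff_SucI[OF bounded_bilinear.FDERIV[OF assms
            C_diff_SucD(1)[OF Suc.prems(1)] C_diff_SucD(1)[OF Suc.prems(2)]]])
       (intro C_diff_add Suc.IH C_diff_SucD(2)[OF Suc.prems(1)] C_diff_SucD(2)[OF Suc.prems(2)]
          \<open>C_diff k f\<close> \<open>C_diff k g\<close>)
qed

text \<open>In the chain rule the direction \<open>frechet_derivative g (at x) v\<close> varies with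
  \<open>x\<close>, while \<open>C_diff\<close> speaks of fixed directions. Expanding it in the
  basis leaves coordinates times partial derivatives of \<open>f\<close> composed with
  \<open>g\<close>, to which the induction hypothesis applies.\<close>

lemma C_diff_compose:
  fixes f :: "'b::euclidean_space \<Rightarrow> 'c::real_normed_vector"
  shows "C_diff k f \<Longrightarrow> C_diff k g \<Longrightarrow> C_diff k (\<lambda>x. f (g x))"
proof (induction k arbitrary: f)
  case 0
  then show ?case by (auto intro: continuous_on_compose2)
next
  case (Suc k)
  note f = C_diff_SucD[OF Suc.prems(1)] and g = C_diff_SucD[OF Suc.prems(2)]
  have gk: "C_diff k g"
    using Suc.prems C_diff_le[OF _ le_SucI[OF order_refl]] by auto
  let ?f' = "\<lambda>x. frechet_derivative f (at (g x))" and ?g' = "\<lambda>x. frechet_derivative g (at x)"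
  have expand: "?f' x (?g' x v) = (\<Sum>b\<in>Basis. (?g' x v \<bullet> b) *\<^sub>R ?f' x b)" for x v
  proof -
    interpret linear "?f' x" using f(1) has_derivative_linear by blast
    have "?f' x (?g' x v) = ?f' x (\<Sum>b\<in>Basis. (?g' x v \<bullet> b) *\<^sub>R b)"
      by (simp add: euclidean_representation)
    then show ?thesis by (simp add: sum scale)
  qed
  show ?case
  proof (rule C_diff_SucI[where f'="\<lambda>x v. ?f' x (?g' x v)"])
    show "((\<lambda>x. f (g x)) has_derivative (\<lambda>v. ?f' x (?g' x v))) (at x)" for x
      using has_derivative_compose[OF g(1) f(1)] .
    show "C_diff k (\<lambda>x. ?f' x (?g' x v))" for v
      unfolding expand
      by (intro C_diff_sum C_diff_bounded_bilinear[OF bounded_bilinear_scaleR]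
           C_diff_bounded_linear_compose[OF bounded_linear_inner_left] g(2) Suc.IH f(2) gk)
  qed
qed

text \<open>The derivative is a product of the inverse itself, the derivative of \<open>f\<close>
  and the inverse again, so the induction hypothesis for the same \<open>f\<close> suffices.\<close>

lemma C_diff_inverse:
  fixes f :: "'a::real_normed_vector \<Rightarrow> real"
  assumes nz: "\<And>x. f x \<noteq> 0"
  shows "C_diff k f \<Longrightarrow> C_diff k (\<lambda>x. inverse (f x))"
proof (induction k)
  case 0
  then show ?case using nz by (auto intro: continuous_intros)
next
  case (Suc k)
  have fk: "C_diff k f"
    using Suc.prems C_diff_le[OF _ le_SucI[OF order_refl]] by auto
  show ?case
    by (rule C_diff_SucI[where f'="\<lambda>x v. - (inverse (f x) * frechet_derivative f (at x) v * inverse (f x))"])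
       (use Suc C_diff_SucD[OF Suc.prems] nz fk in
         \<open>auto intro!: has_derivative_inverse C_diff_bounded_linear_compose[OF bounded_linear_minus]
            C_diff_bounded_bilinear[OF bounded_bilinear_mult] bounded_linear_ident\<close>)
qed

text \<open>Differentiation under the integral sign: a directional derivative in \<open>x\<close> is
  again an integral of the same kind, its integrand being the derivative of \<open>f\<close> along
  \<open>(v, 0)\<close>. Hence the order can be raised by induction.\<close>

lemma C_diff_integral:
  fixes f :: "'a::euclidean_space \<times> real \<Rightarrow> 'b::euclidean_space"
  shows "C_diff k f \<Longrightarrow> C_diff k (\<lambda>x. integral {0..1} (\<lambda>t. f (x, t)))"
    and "C_diff (Suc k) f \<Longrightarrow> ((\<lambda>x. integral {0..1} (\<lambda>t. f (x, t))) has_derivative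
      (\<lambda>v. integral {0..1} (\<lambda>t. frechet_derivative f (at (x, t)) (v, 0)))) (at x)"
proof -
  show "((\<lambda>x. integral {0..1} (\<lambda>t. f (x, t))) has_derivative
      (\<lambda>v. integral {0..1} (\<lambda>t. frechet_derivative f (at (x, t)) (v, 0)))) (at x)"
    if f: "C_diff (Suc k) f" for f :: "'a \<times> real \<Rightarrow> 'b" and k x
  proof -
    let ?f' = "\<lambda>x t v. frechet_derivative f (at (x, t)) (v, 0)"
    have d: "((\<lambda>x. f (x, t)) has_derivative ?f' x t) (at x)" for x t
      using has_derivative_compose[OF has_derivative_Pair[OF has_derivative_ident has_derivative_const]
          C_diff_SucD(1)[OF f]] .
    \<comment> \<open>\<open>leibniz_rule\<close> takes the derivative as a continuous family of
      bounded linear maps; in finite dimension its continuity can be tested on basis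
      vectors.\<close>
    define F where "F = (\<lambda>x t. Blinfun (?f' x t))"
    have F: "blinfun_apply (F x t) = ?f' x t" for x t
      unfolding F_def using has_derivative_bounded_linear[OF d] by (rule bounded_linear_Blinfun_apply)
    have cont: "continuous_on UNIV (\<lambda>(x, t). F x t)"
    proof (rule continuous_on_blinfun_componentwise)
      fix i :: 'a assume "i \<in> Basis"
      show "continuous_on UNIV (\<lambda>z. blinfun_apply (case z of (x, t) \<Rightarrow> F x t) i)"
        using C_diff_imp_continuous_on[OF C_diff_SucD(2)[OF f, of "(i, 0)"]]
        by (simp add: case_prod_beta F)
    qed
    have cf: "continuous_on S (\<lambda>t. f (x, t))" for S x
      by (rule continuous_on_compose2[OF C_diff_imp_continuous_on[OF f]]) (auto intro: continuous_intros)
    have cF: "continuous_on S (\<lambda>t. F x t)" for S x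
      using continuous_on_compose2[OF cont continuous_on_Pair[OF continuous_on_const continuous_on_id], of x S]
      by simp
    have "((\<lambda>x. integral (cbox 0 1) (\<lambda>t. f (x, t))) has_derivative integral (cbox 0 1) (F x)) (at x)"
      by (rule leibniz_rule[where U=UNIV, OF _ integrable_continuous[OF cf] continuous_on_subset[OF cont]])
         (simp_all add: F d)
    moreover have "blinfun_apply (integral {0..1} (F x)) = (\<lambda>v. integral {0..1} (\<lambda>t. ?f' x t v))"
    proof (rule ext)
      show "blinfun_apply (integral {0..1} (F x)) v = integral {0..1} (\<lambda>t. ?f' x t v)" for v
        using integral_linear[OF integrable_continuous_interval[OF cF] blinfun.bounded_linear_left, of 0 1 v x]
        by (simp add: o_def F)
    qed
    ultimately show ?thesis by (simp add: cbox_interval)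
  qed
  note deriv = this
  show "C_diff k f \<Longrightarrow> C_diff k (\<lambda>x. integral {0..1} (\<lambda>t. f (x, t)))"
  proof (induction k arbitrary: f)
    case 0
    then show ?case
      using integral_continuous_on_param[of UNIV 0 1 "\<lambda>x t. f (x, t)"]
      by (auto intro: continuous_on_subset)
  next
    case (Suc k)
    show ?case
      by (rule C_diff_SucI[OF deriv[OF Suc.prems]])
         (rule Suc.IH[of "\<lambda>y. frechet_derivative f (at y) (v, 0)" for v], rule C_diff_SucD(2)[OF Suc.prems])
  qed
qed

section \<open>Closure properties of smooth maps\<close>

lemma smooth_const [simp]: "smooth (\<lambda>x. c)"
  and smooth_ident: "smooth (\<lambda>x. x)"
  and smooth_bounded_linear: "bounded_linear h \<Longrightarrow> smooth h"
  and smooth_bounded_linear_compose: "bounded_linear h \<Longrightarrow> smooth f \<Longrightarrow> smooth (\<lambda>x. h (f x))"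
  and smooth_add: "smooth f \<Longrightarrow> smooth g \<Longrightarrow> smooth (\<lambda>x. f x + g x)"
  and smooth_sum: "(\<And>i. i \<in> I \<Longrightarrow> smooth (F i)) \<Longrightarrow> smooth (\<lambda>x. \<Sum>i\<in>I. F i x)"
  and smooth_bounded_bilinear:
    "bounded_bilinear p \<Longrightarrow> smooth f \<Longrightarrow> smooth g' \<Longrightarrow> smooth (\<lambda>x. p (f x) (g' x))"
  by (simp_all add: smooth_def C_diff_ident C_diff_bounded_linear C_diff_bounded_linear_compose
      C_diff_add C_diff_sum C_diff_bounded_bilinear)

lemma smooth_compose:
  fixes f :: "'b::euclidean_space \<Rightarrow> 'c::real_normed_vector"
  shows "smooth f \<Longrightarrow> smooth g \<Longrightarrow> smooth (\<lambda>x. f (g x))"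
  by (simp add: smooth_def C_diff_compose)

lemma smooth_inverse:
  fixes f :: "'a::real_normed_vector \<Rightarrow> real"
  shows "(\<And>x. f x \<noteq> 0) \<Longrightarrow> smooth f \<Longrightarrow> smooth (\<lambda>x. inverse (f x))"
  by (simp add: smooth_def C_diff_inverse)

lemma smooth_integral:
  fixes f :: "'a::euclidean_space \<times> real \<Rightarrow> 'b::euclidean_space"
  shows "smooth f \<Longrightarrow> smooth (\<lambda>x. integral {0..1} (\<lambda>t. f (x, t)))"
  by (simp add: smooth_def C_diff_integral)

lemma smooth_minus: "smooth f \<Longrightarrow> smooth (\<lambda>x. - f x)"
  by (rule smooth_bounded_linear_compose[OF bounded_linear_minus[OF bounded_linear_ident]])

lemma smooth_diff: "smooth f \<Longrightarrow> smooth g \<Longrightarrow> smooth (\<lambda>x. f x - g x)"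
  using smooth_add[OF _ smooth_minus, of f g] by simp

lemma smooth_scaleR: "smooth f \<Longrightarrow> smooth g \<Longrightarrow> smooth (\<lambda>x. f x *\<^sub>R g x)"
  by (rule smooth_bounded_bilinear[OF bounded_bilinear_scaleR])

lemma smooth_Pair:
  assumes "smooth f" "smooth g"
  shows "smooth (\<lambda>x. (f x, g x))"
proof -
  have "smooth (\<lambda>x. (f x, 0) + (0, g x))"
    by (intro smooth_add smooth_bounded_linear_compose[OF _ assms(1)]
        smooth_bounded_linear_compose[OF _ assms(2)]
        bounded_linear_Pair bounded_linear_ident bounded_linear_zero)
  then show ?thesis by simp
qed

lemma smooth_fst: "smooth f \<Longrightarrow> smooth (\<lambda>x. fst (f x))"
  and smooth_snd: "smooth f \<Longrightarrow> smooth (\<lambda>x. snd (f x))"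
  by (auto intro: smooth_bounded_linear_compose bounded_linear_fst bounded_linear_snd)

lemma smooth_has_derivative:
  "smooth f \<Longrightarrow> (f has_derivative frechet_derivative f (at x)) (at x)"
  unfolding smooth_def by (rule C_diff_SucD(1)[of 0]) blast

lemma smooth_frechet_derivative: "smooth f \<Longrightarrow> smooth (\<lambda>x. frechet_derivative f (at x) v)"
  unfolding smooth_def using C_diff_SucD(2) by blast

lemma smooth_continuous_on: "smooth f \<Longrightarrow> continuous_on S f"
  unfolding smooth_def using C_diff_imp_continuous_on continuous_on_subset by blast

text \<open>\<open>f\<close> is the sum of its coordinates put back in place by the bounded linear
  maps \<open>axis i\<close>.\<close>

lemma smooth_vec_iff:
  "smooth (f :: 'a::real_normed_vector \<Rightarrow> 'b::real_normed_vector^'n) \<longleftrightarrow> (\<forall>i. smooth (\<lambda>x. f x $ i))"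
proof
  assume "\<forall>i. smooth (\<lambda>x. f x $ i)"
  moreover have "bounded_linear (axis i :: 'b \<Rightarrow> 'b^'n)" for i
  proof (rule bounded_linear_intro[where K=1])
    show "norm (axis i x :: 'b^'n) \<le> norm x * 1" for x :: 'b
    proof -
      have "norm (axis i x :: 'b^'n) \<le> (\<Sum>j\<in>UNIV. norm ((axis i x :: 'b^'n) $ j))"
        unfolding norm_vec_def by (rule L2_set_le_sum) simp
      also have "\<dots> = (\<Sum>j\<in>UNIV. if j = i then norm x else 0)"
        by (rule sum.cong) (auto simp: axis_def)
      finally show ?thesis by simp
    qed
  qed (auto simp: vec_eq_iff axis_def)
  ultimately have "smooth (\<lambda>x. \<Sum>i\<in>UNIV. axis i (f x $ i))"
    by (intro smooth_sum smooth_bounded_linear_compose[of "axis _"]) blast+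
  moreover have "(\<Sum>i\<in>UNIV. axis i (f x $ i)) = f x" for x
  proof -
    have "(\<Sum>i\<in>UNIV. axis i (f x $ i) $ j) = (\<Sum>i\<in>UNIV. if i = j then f x $ j else 0)" for j
      by (rule sum.cong) (auto simp: axis_def)
    then show ?thesis by (simp add: vec_eq_iff)
  qed
  ultimately show "smooth f" by simp
qed (auto intro: smooth_bounded_linear_compose bounded_linear_vec_nth)

section \<open>Integrals along segments: symmetry of second derivatives and difference
  quotients\<close>

lemma smooth_segment_integral:
  fixes f :: "'a::euclidean_space \<Rightarrow> 'b::euclidean_space"
  assumes "smooth f"
  shows "f (y + v) = f y + integral {0..1} (\<lambda>t. frechet_derivative f (at (y + t *\<^sub>R v)) v)"
proof -
  have "((\<lambda>t. f (y + t *\<^sub>R v)) has_vector_derivative frechet_derivative f (at (y + t *\<^sub>R v)) v) (at t within {0..1})"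
    for t :: real
  proof -
    have lin: "linear (frechet_derivative f (at (y + t *\<^sub>R v)))"
      using smooth_has_derivative[OF assms] has_derivative_linear by blast
    have "((\<lambda>t. y + t *\<^sub>R v) has_derivative (\<lambda>h. h *\<^sub>R v)) (at t within {0..1})"
      by (auto intro!: derivative_eq_intros)
    from has_derivative_compose[OF this smooth_has_derivative[OF assms]]
    show ?thesis unfolding has_vector_derivative_def
      by (simp add: linear_cmul[OF lin])
  qed
  from fundamental_theorem_of_calculus[OF _ this]
  show ?thesis by (simp add: integral_unique)
qed

text \<open>Differentiate \<open>f (y + t v) = f y + t \<integral> f' (y + \<tau> t v) v d\<tau>\<close> first in \<open>y\<close> in direction \<open>u\<close>,
  then in \<open>t\<close> at \<open>0\<close>.\<close>

lemma frechet_derivative_commute: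
  fixes f :: "'a::euclidean_space \<Rightarrow> 'b::euclidean_space"
  assumes f: "smooth f"
  shows "frechet_derivative (\<lambda>y. frechet_derivative f (at y) v) (at x) u =
         frechet_derivative (\<lambda>y. frechet_derivative f (at y) u) (at x) v"
proof -
  let ?D = "\<lambda>w y. frechet_derivative f (at y) w"
  let ?DD = "\<lambda>y. frechet_derivative (?D v) (at y) u"
  define J where "J t = integral {0..1} (\<lambda>\<tau>. ?DD (x + (\<tau> * t) *\<^sub>R v))" for t :: real
  note D = smooth_frechet_derivative[OF f]
  have f_eq: "f (y + t *\<^sub>R v) = f y + t *\<^sub>R integral {0..1} (\<lambda>\<tau>. ?D v (y + (\<tau> * t) *\<^sub>R v))" for y t
  proof -
    have "linear (\<lambda>w. ?D w z)" for z
      using smooth_has_derivative[OF f] has_derivative_linear by blast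
    then show ?thesis
      using smooth_segment_integral[OF f, of y "t *\<^sub>R v"] by (simp add: linear_cmul)
  qed
  have u_eq: "?D u (x + t *\<^sub>R v) = ?D u x + t *\<^sub>R J t" for t
  proof -
    let ?F = "\<lambda>z. ?D v (fst z + (snd z * t) *\<^sub>R v)"
    let ?g = "\<lambda>z::'a \<times> real. fst z + (snd z * t) *\<^sub>R v"
    have bl: "bounded_linear ?g"
      by (intro bounded_linear_add bounded_linear_fst
            bounded_linear_scaleR_left[THEN bounded_linear_compose]
            bounded_linear_mult_left[THEN bounded_linear_compose] bounded_linear_snd)
    have F: "smooth ?F" by (rule smooth_compose[OF D smooth_bounded_linear[OF bl]])
    have dF: "frechet_derivative ?F (at (x, \<tau>)) (u, 0) = ?DD (x + (\<tau> * t) *\<^sub>R v)" for \<tau>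
    proof -
      from has_derivative_compose[OF bounded_linear_imp_has_derivative[OF bl] smooth_has_derivative[OF D]]
      have "frechet_derivative ?F (at (x, \<tau>)) = (\<lambda>z. frechet_derivative (?D v) (at (?g (x, \<tau>))) (?g z))"
        by (rule frechet_derivative_at[symmetric])
      then show ?thesis by simp
    qed
    have "((\<lambda>y. integral {0..1} (\<lambda>\<tau>. ?F (y, \<tau>))) has_derivative
        (\<lambda>w. integral {0..1} (\<lambda>\<tau>. frechet_derivative ?F (at (x, \<tau>)) (w, 0)))) (at x)"
      using C_diff_integral(2)[of 0 ?F x] F by (auto simp: smooth_def simp del: C_diff.simps)
    then have "((\<lambda>y. f y + t *\<^sub>R integral {0..1} (\<lambda>\<tau>. ?F (y, \<tau>))) has_derivative
        (\<lambda>w. ?D w x + t *\<^sub>R integral {0..1} (\<lambda>\<tau>. frechet_derivative ?F (at (x, \<tau>)) (w, 0)))) (at x)"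
      by (intro has_derivative_add has_derivative_scaleR_right smooth_has_derivative f)
    moreover have "((\<lambda>y. f (y + t *\<^sub>R v)) has_derivative (\<lambda>w. ?D w (x + t *\<^sub>R v))) (at x)"
      by (rule has_derivative_compose[OF _ smooth_has_derivative[OF f]])
         (auto intro!: derivative_eq_intros)
    ultimately have "(\<lambda>w. ?D w (x + t *\<^sub>R v)) =
       (\<lambda>w. ?D w x + t *\<^sub>R integral {0..1} (\<lambda>\<tau>. frechet_derivative ?F (at (x, \<tau>)) (w, 0)))"
      unfolding f_eq fst_conv snd_conv by (rule has_derivative_unique[symmetric])
    then show ?thesis by (simp add: fun_eq_iff dF J_def)
  qed
  have "smooth J"
    unfolding J_def
    by (rule smooth_integral[of "\<lambda>z. ?DD (x + (snd z * fst z) *\<^sub>R v)", simplified],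
        rule smooth_compose[OF smooth_frechet_derivative[OF D]])
       (intro smooth_add smooth_const smooth_scaleR smooth_fst smooth_snd smooth_ident
          smooth_bounded_bilinear[OF bounded_bilinear_mult])
  \<comment> \<open>At \<open>t = 0\<close> the derivative of \<open>J\<close> is multiplied by
    \<open>0\<close>, so only \<open>J 0\<close> survives.\<close>
  then have "((\<lambda>t. ?D u x + t *\<^sub>R J t) has_derivative (\<lambda>h. h *\<^sub>R J 0)) (at 0)"
    using has_derivative_add[OF has_derivative_const
        has_derivative_scaleR[OF has_derivative_ident smooth_has_derivative[of J 0]]] by simp
  moreover have "((\<lambda>t. ?D u (x + t *\<^sub>R v)) has_derivative
      (\<lambda>h. frechet_derivative (?D u) (at (x + 0 *\<^sub>R v)) (h *\<^sub>R v))) (at 0)"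
    by (rule has_derivative_compose[OF _ smooth_has_derivative[OF D]])
       (auto intro!: derivative_eq_intros)
  ultimately have "(\<lambda>h. frechet_derivative (?D u) (at (x + 0 *\<^sub>R v)) (h *\<^sub>R v)) = (\<lambda>h. h *\<^sub>R J 0)"
    unfolding u_eq by (rule has_derivative_unique[symmetric])
  from fun_cong[OF this, of 1] show ?thesis by (simp add: J_def)
qed

text \<open>The quotient is the integral of the \<open>z\<close>-derivative over the segment from
  \<open>a\<close> to \<open>z\<close>; in this form it is smooth jointly in \<open>(x, z)\<close>,
  also at \<open>z = a\<close>.\<close>

lemma smooth_holomorphic_divide:
  fixes f :: "'a::euclidean_space \<Rightarrow> complex \<Rightarrow> complex"
  assumes f: "smooth (\<lambda>(x, z). f x z)" and hol: "\<And>x. f x holomorphic_on UNIV"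
  obtains g where "smooth (\<lambda>(x, z). g x z)" "\<And>x. g x holomorphic_on UNIV"
    "\<And>x z. f x z = f x a + (z - a) * g x z"
proof
  let ?f = "\<lambda>(x, z). f x z"
  define D where "D y = frechet_derivative ?f (at y) (0, 1)" for y
  define g where "g x z = integral {0..1} (\<lambda>t. D (x, a + t *\<^sub>R (z - a)))" for x z
  \<comment> \<open>Holomorphy makes the real derivative in \<open>z\<close> complex linear, so the
    single direction \<open>(0, 1)\<close> determines it and \<open>z - a\<close> comes out of the
    integral.\<close>
  have D_mult: "frechet_derivative ?f (at (x, z)) (0, w) = w * D (x, z)" for x z w
  proof -
    obtain d where "(f x has_field_derivative d) (at z)"
      using hol[of x] by (auto simp: holomorphic_on_def field_differentiable_def)
    then have "(f x has_derivative (*) d) (at z)" by (simp add: has_field_derivative_def)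
    moreover have "(f x has_derivative (\<lambda>w. frechet_derivative ?f (at (x, z)) (0, w))) (at z)"
      using has_derivative_compose[OF has_derivative_Pair[OF has_derivative_const has_derivative_ident]
          smooth_has_derivative[OF f]] by (simp add: case_prod_unfold)
    ultimately have "(\<lambda>w. frechet_derivative ?f (at (x, z)) (0, w)) = (*) d"
      by (rule has_derivative_unique[symmetric])
    then show ?thesis by (simp add: fun_eq_iff D_def)
  qed
  show eq: "f x z = f x a + (z - a) * g x z" for x z
    using smooth_segment_integral[OF f, of "(x, a)" "(0, z - a)"]
    by (simp add: D_mult g_def)
  have "smooth (\<lambda>z. D (fst (fst z), a + snd z *\<^sub>R (snd (fst z) - a)))"
    unfolding D_def
    by (rule smooth_compose[OF smooth_frechet_derivative[OF f]])
       (intro smooth_Pair smooth_add smooth_diff smooth_const smooth_scaleR smooth_fst smooth_snd smooth_ident)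
  from smooth_integral[OF this] show g: "smooth (\<lambda>(x, z). g x z)"
    by (simp add: g_def case_prod_unfold)
  show "g x holomorphic_on UNIV" for x
  \<comment> \<open>Away from \<open>a\<close> this is an ordinary difference quotient; continuity
    makes the singularity at \<open>a\<close> removable.\<close>
  proof (rule no_isolated_singularity[of UNIV "g x" "{a}"])
    show "continuous_on UNIV (g x)"
      using continuous_on_compose2[OF smooth_continuous_on[OF g]
          continuous_on_Pair[OF continuous_on_const continuous_on_id] subset_UNIV]
      by simp
    have "(\<lambda>z. (f x z - f x a) / (z - a)) holomorphic_on UNIV - {a}"
      by (intro holomorphic_intros holomorphic_on_subset[OF hol]) auto
    then show "g x holomorphic_on UNIV - {a}"
    proof (rule holomorphic_transform)
      show "(f x z - f x a) / (z - a) = g x z" if "z \<in> UNIV - {a}" for z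
        using that eq[of x z] by simp
    qed
  qed auto
qed

lemma smooth_holomorphic_in_param_divide:
  fixes F :: "'a::euclidean_space \<Rightarrow> complex \<Rightarrow> complex^'k^'l"
  assumes F: "smooth (\<lambda>(x, z). F x z)" and hol: "holomorphic_in_param F"
  obtains G where "smooth (\<lambda>(x, z). G x z)" "holomorphic_in_param G"
    "\<And>x z. F x z = F x a + (z - a) \<cdot>\<^sub>m G x z"
proof -
  let ?P = "\<lambda>i j g. smooth (\<lambda>(x, z). g x z) \<and> (\<forall>x. g x holomorphic_on UNIV) \<and>
    (\<forall>x z. F x z $ i $ j = F x a $ i $ j + (z - a) * g x z)"
  have "\<exists>g. ?P i j g" for i j
  proof -
    have "smooth (\<lambda>(x, z). F x z $ i $ j)"
      using F by (simp add: case_prod_unfold smooth_vec_iff)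
    moreover have "(\<lambda>z. F x z $ i $ j) holomorphic_on UNIV" for x
      using hol by (simp add: holomorphic_in_param_def)
    ultimately show ?thesis by (rule smooth_holomorphic_divide[of "\<lambda>x z. F x z $ i $ j" a]) blast
  qed
  then have "\<forall>i j. \<exists>g. ?P i j g" by blast
  then obtain g where g_all: "\<forall>i j. ?P i j (g i j)"
    unfolding choice_iff by blast
  have g: "smooth (\<lambda>(x, z). g i j x z)" "g i j x holomorphic_on UNIV" for i j x
    using g_all by blast+
  have F_eq: "F x a $ i $ j + (z - a) * g i j x z = F x z $ i $ j" for i j x z
    by (rule sym) (use g_all in blast)
  show ?thesis
  proof (rule that)
    show "F x z = F x a + (z - a) \<cdot>\<^sub>m (\<chi> i j. g i j x z)" for x z
      by (simp add: vec_eq_iff mscale_def F_eq)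
  qed (use g in \<open>simp_all add: holomorphic_in_param_def smooth_vec_iff case_prod_unfold\<close>)
qed

lemma smooth_slice:
  fixes F :: "'a::euclidean_space \<Rightarrow> 'b::euclidean_space \<Rightarrow> 'c::real_normed_vector"
  assumes "smooth (\<lambda>(x, z). F x z)"
  shows "smooth (\<lambda>x. F x z)" "smooth (F x)"
  using smooth_compose[OF assms smooth_Pair[OF smooth_ident smooth_const]]
    smooth_compose[OF assms smooth_Pair[OF smooth_const smooth_ident]] by simp_all

text \<open>The joint derivative along \<open>(w, 0)\<close> is smooth in \<open>z\<close> as well,
  which allows the frame equation to be continued to the poles.\<close>

lemma has_derivative_slice:
  fixes F :: "'a::real_normed_vector \<Rightarrow> 'b::real_normed_vector \<Rightarrow> 'c::real_normed_vector"
  assumes "smooth (\<lambda>(x, z). F x z)"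
  shows "((\<lambda>y. F y z) has_derivative (\<lambda>w. frechet_derivative (\<lambda>(x, z). F x z) (at (x, z)) (w, 0))) (at x)"
  using has_derivative_compose[OF has_derivative_Pair[OF has_derivative_ident has_derivative_const]
      smooth_has_derivative[OF assms]] by simp

text \<open>The complement of two points is dense. This carries identities known for
  \<open>z \<noteq> \<plusminus>a\<close> over to the poles; with \<open>b = c\<close> it restores a
  single point.\<close>

lemma smooth_eq_off_two_points:
  fixes f g :: "complex \<Rightarrow> 'b::real_normed_vector"
  assumes "smooth f" "smooth g" and eq: "\<And>z. z \<noteq> b \<Longrightarrow> z \<noteq> c \<Longrightarrow> f z = g z"
  shows "f z = g z"
proof -
  have "closure (- {b, c}) = UNIV"
    by (simp add: closure_complement empty_interior_finite)
  then have "f z - g z = 0"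
    using continuous_constant_on_closure[of "- {b, c}" "\<lambda>z. f z - g z" 0 z] eq
      smooth_continuous_on[OF smooth_diff[OF assms(1,2)]] by auto
  then show ?thesis by simp
qed

section \<open>Complex matrices\<close>

lemma mscale_nth [simp]: "(c \<cdot>\<^sub>m A) $ i $ j = c * A $ i $ j"
  by (simp add: mscale_def)

lemma mscale_simps [simp]:
  "0 \<cdot>\<^sub>m A = 0" "1 \<cdot>\<^sub>m A = A" "c \<cdot>\<^sub>m 0 = 0" "c \<cdot>\<^sub>m d \<cdot>\<^sub>m A = (c * d) \<cdot>\<^sub>m A"
  by (simp_all add: vec_eq_iff)

lemma mscale_distrib:
  "c \<cdot>\<^sub>m (A + B) = c \<cdot>\<^sub>m A + c \<cdot>\<^sub>m B" "c \<cdot>\<^sub>m (A - B) = c \<cdot>\<^sub>m A - c \<cdot>\<^sub>m B"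
  "c \<cdot>\<^sub>m (- A) = - (c \<cdot>\<^sub>m A)"
  by (simp_all add: vec_eq_iff algebra_simps)

lemma mscale_mult_left [simp]: "(c \<cdot>\<^sub>m A) ** B = c \<cdot>\<^sub>m (A ** B)"
  and mscale_mult_right [simp]: "A ** (c \<cdot>\<^sub>m B) = c \<cdot>\<^sub>m (A ** B)"
  by (simp_all add: vec_eq_iff matrix_matrix_mult_def sum_distrib_left mult_ac)

lemma transpose_mscale [simp]: "transpose (c \<cdot>\<^sub>m A) = c \<cdot>\<^sub>m transpose A"
  by (simp add: vec_eq_iff transpose_def)

lemma transpose_add: "transpose (A + B) = transpose A + transpose B"
  and transpose_diff: "transpose (A - B) = transpose A - transpose (B :: 'a::ring_1^'n^'m)"
  and transpose_minus: "transpose (- B) = - transpose B"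
  by (simp_all add: vec_eq_iff transpose_def)

lemma matrix_minus_left [simp]: "(- A) ** B = - (A ** B)"
  and matrix_minus_right [simp]: "A ** (- B) = - (A ** (B :: 'a::ring_1^'n^'m))"
  and matrix_diff_ldistrib: "A ** (B - B') = A ** B - A ** B'"
  and matrix_diff_rdistrib: "(A - A') ** B = A ** B - A' ** B"
  and matrix_zero_left [simp]: "0 ** B = 0"
  and matrix_zero_right [simp]: "A ** 0 = 0"
  by (simp_all add: vec_eq_iff matrix_matrix_mult_def sum_negf sum_subtractf algebra_simps)

lemma matrix_add_rdistrib: "(A + A') ** B = A ** B + A' ** (B :: 'a::semiring_1^'n^'m)"
  by (simp add: vec_eq_iff matrix_matrix_mult_def sum.distrib algebra_simps)

lemmas matrix_distrib =
  matrix_add_ldistrib matrix_add_rdistrib matrix_diff_ldistrib matrix_diff_rdistrib mscale_distrib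

lemma map_matrix_cnj_simps:
  "map_matrix cnj (A + B) = map_matrix cnj A + map_matrix cnj B"
  "map_matrix cnj (A - B) = map_matrix cnj A - map_matrix cnj B"
  "map_matrix cnj (C ** D) = map_matrix cnj C ** map_matrix cnj D"
  "map_matrix cnj (c \<cdot>\<^sub>m A) = cnj c \<cdot>\<^sub>m map_matrix cnj A"
  "map_matrix cnj (transpose A) = transpose (map_matrix cnj A)"
  "map_matrix cnj (map_matrix cnj A) = A"
  "map_matrix cnj (mat 1 :: complex^'k^'k) = mat 1"
  by (simp_all add: vec_eq_iff matrix_matrix_mult_def transpose_def mat_def)

lemma bounded_bilinear_matrix_mult:
  "bounded_bilinear ((**) :: complex^'n^'m \<Rightarrow> complex^'k^'n \<Rightarrow> complex^'k^'m)"
  unfolding bilinear_conv_bounded_bilinear[symmetric] bilinear_def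
  by (auto intro!: linearI simp: matrix_add_ldistrib matrix_add_rdistrib)
     (simp_all add: vec_eq_iff matrix_matrix_mult_def scaleR_sum_right)

lemma bounded_bilinear_mscale: "bounded_bilinear ((\<cdot>\<^sub>m) :: complex \<Rightarrow> complex^'n^'m \<Rightarrow> complex^'n^'m)"
  unfolding bilinear_conv_bounded_bilinear[symmetric] bilinear_def
  by (auto intro!: linearI simp: vec_eq_iff algebra_simps)

lemma bounded_bilinear_matrix_vector_mult:
  "bounded_bilinear ((*v) :: complex^'n^'m \<Rightarrow> complex^'n \<Rightarrow> complex^'m)"
  unfolding bilinear_conv_bounded_bilinear[symmetric] bilinear_def
  by (auto intro!: linearI simp: matrix_vector_right_distrib matrix_vector_mult_add_rdistrib)
     (simp_all add: vec_eq_iff matrix_vector_mult_def scaleR_sum_right)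

lemma bounded_linear_transpose: "bounded_linear (transpose :: complex^'n^'m \<Rightarrow> _)"
  unfolding linear_conv_bounded_linear[symmetric]
  by (auto intro!: linearI simp: vec_eq_iff transpose_def)

lemma holomorphic_in_param_const: "holomorphic_in_param (\<lambda>x z. C x)"
  and holomorphic_in_param_add:
    "holomorphic_in_param F \<Longrightarrow> holomorphic_in_param G \<Longrightarrow> holomorphic_in_param (\<lambda>x z. F x z + G x z)"
  and holomorphic_in_param_diff:
    "holomorphic_in_param F \<Longrightarrow> holomorphic_in_param G \<Longrightarrow> holomorphic_in_param (\<lambda>x z. F x z - G x z)"
  and holomorphic_in_param_mscale:
    "holomorphic_in_param F \<Longrightarrow> holomorphic_in_param (\<lambda>x z. c \<cdot>\<^sub>m F x z)"
  and holomorphic_in_param_mult: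
    "holomorphic_in_param F \<Longrightarrow> holomorphic_in_param H \<Longrightarrow> holomorphic_in_param (\<lambda>x z. F x z ** H x z)"
  by (auto simp: holomorphic_in_param_def matrix_matrix_mult_def intro!: holomorphic_intros)

lemma smooth_matrix_mult:
  fixes F :: "'a::real_normed_vector \<Rightarrow> complex^'n^'m"
  shows "smooth F \<Longrightarrow> smooth G \<Longrightarrow> smooth (\<lambda>x. F x ** G x)"
  by (rule smooth_bounded_bilinear[OF bounded_bilinear_matrix_mult])

lemma smooth_mscale: "smooth c \<Longrightarrow> smooth F \<Longrightarrow> smooth (\<lambda>x. c x \<cdot>\<^sub>m F x)"
  by (rule smooth_bounded_bilinear[OF bounded_bilinear_mscale])

section \<open>The complex bilinear form and rank one matrices\<close>

text \<open>No conjugation is involved: \<open>transpose\<close> is the adjoint for this form,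
  complex orthogonal matrices preserve it, and non-zero vectors may be isotropic.\<close>

definition bdot :: "complex^'k \<Rightarrow> complex^'k \<Rightarrow> complex" where
  "bdot v w = (\<Sum>i\<in>UNIV. v $ i * w $ i)"

definition oprod :: "complex^'m \<Rightarrow> complex^'n \<Rightarrow> complex^'n^'m" where
  "oprod v w = (\<chi> i j. v $ i * w $ j)"

lemma bdot_commute: "bdot v w = bdot w v"
  by (simp add: bdot_def mult.commute)

lemma bdot_transpose: "bdot (transpose A *v v) w = bdot v (A *v w)"
proof -
  have "bdot (transpose A *v v) w = (\<Sum>i\<in>UNIV. \<Sum>j\<in>UNIV. A $ j $ i * v $ j * w $ i)"
    by (simp add: bdot_def matrix_vector_mult_def transpose_def sum_distrib_right
        del: transpose_matrix_vector)
  also have "\<dots> = (\<Sum>j\<in>UNIV. \<Sum>i\<in>UNIV. A $ j $ i * v $ j * w $ i)"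
    by (rule sum.swap)
  also have "\<dots> = bdot v (A *v w)"
    by (simp add: bdot_def matrix_vector_mult_def sum_distrib_left mult_ac)
  finally show ?thesis .
qed

lemma matrix_oprod: "A ** oprod v w = oprod (A *v v) w"
  and oprod_matrix: "oprod v w ** B = oprod v (transpose B *v w)"
  and oprod_oprod: "oprod v w ** oprod v' w' = bdot w v' \<cdot>\<^sub>m oprod v w'"
  and transpose_oprod: "transpose (oprod v w) = oprod w v"
  by (simp_all add: vec_eq_iff oprod_def matrix_matrix_mult_def matrix_vector_mult_def transpose_def
      bdot_def sum_distrib_left sum_distrib_right mult_ac del: transpose_matrix_vector)

lemma oprod_minus: "oprod (- v) w = - oprod v w" "oprod v (- w) = - oprod v w"
  by (simp_all add: vec_eq_iff oprod_def)

lemma bounded_bilinear_oprod: "bounded_bilinear (oprod :: complex^'m \<Rightarrow> complex^'n \<Rightarrow> _)"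
  unfolding bilinear_conv_bounded_bilinear[symmetric] bilinear_def
  by (auto intro!: linearI simp: vec_eq_iff oprod_def algebra_simps)

lemma bounded_bilinear_bdot: "bounded_bilinear (bdot :: complex^'m \<Rightarrow> _)"
  unfolding bilinear_conv_bounded_bilinear[symmetric] bilinear_def
  by (auto intro!: linearI simp: bdot_def algebra_simps sum.distrib scaleR_sum_right)

text \<open>The scalar equals its own transpose and, by skewness, its own negative.\<close>

lemma bdot_skew:
  assumes "transpose A = - A"
  shows "bdot v (A *v v) = 0"
proof -
  have "bdot v (A *v v) = bdot (transpose A *v v) v" by (simp only: bdot_transpose)
  also have "\<dots> = - bdot (A *v v) v"
    unfolding assms by (simp add: bdot_def matrix_vector_mult_def sum_negf)
  finally show ?thesis by (simp add: bdot_commute)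
qed

text \<open>\<open>matrix_inv\<close> is a choice; a one-sided inverse of a square matrix is
  two-sided, which determines it.\<close>

lemma matrix_inv_eq:
  fixes A B :: "complex^'k^'k"
  assumes "A ** B = mat 1"
  shows "matrix_inv A = B"
proof -
  have BA: "B ** A = mat 1" using assms matrix_left_right_inverse by metis
  have "A ** matrix_inv A = mat 1 \<and> matrix_inv A ** A = mat 1"
    unfolding matrix_inv_def using assms BA by (rule_tac someI_ex) blast
  then have "B ** (A ** matrix_inv A) = B" by simp
  then show ?thesis by (simp add: matrix_mul_assoc BA)
qed

section \<open>Projections onto isotropic lines\<close>

text \<open>This is \<open>v v\<^sup>* / (v\<^sup>* v)\<close> for \<open>v = W_iZ W Z\<close>: the
  conjugate of \<open>v\<close> is \<open>W_iZ W (- Z)\<close>, and for \<open>W\<close> and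
  \<open>Z\<close> of equal norm the squared norm of \<open>v\<close> is
  \<open>2 * (W \<bullet> W)\<close>.\<close>

definition line_proj :: "real^'m \<Rightarrow> real^'n \<Rightarrow> complex^('m::finite + 'n::finite)^('m + 'n)" where
  "line_proj W Z = inverse (of_real (2 * (W \<bullet> W))) \<cdot>\<^sub>m oprod (W_iZ W Z) (W_iZ W (- Z))"

section \<open>Block matrices and conjugation by \<open>Imn\<close>\<close>

lemma sum_UNIV_Plus:
  "(\<Sum>i\<in>UNIV. f i) = (\<Sum>i\<in>UNIV. f (Inl i)) + (\<Sum>j\<in>UNIV. f (Inr j))"
  for f :: "'a::finite + 'b::finite \<Rightarrow> 'c::comm_monoid_add"
  by (simp add: UNIV_Plus_UNIV[symmetric] sum.Plus del: UNIV_Plus_UNIV)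

lemma W_iZ_nth [simp]: "W_iZ W Z $ Inl i = of_real (W $ i)" "W_iZ W Z $ Inr j = \<i> * of_real (Z $ j)"
  by (simp_all add: W_iZ_def)

lemma block_nth [simp]:
  "block A B C D $ Inl i $ Inl j = A $ i $ j" "block A B C D $ Inl i $ Inr l = B $ i $ l"
  "block A B C D $ Inr k $ Inl j = C $ k $ j" "block A B C D $ Inr k $ Inr l = D $ k $ l"
  by (simp_all add: block_def)

lemma vec_eq_iff_Plus: "v = w \<longleftrightarrow> (\<forall>i. v $ Inl i = w $ Inl i) \<and> (\<forall>j. v $ Inr j = w $ Inr j)"
  for v w :: "'a^('m::finite + 'n::finite)"
  unfolding vec_eq_iff by (auto split: sum.split) (metis sum.exhaust)

lemma bdot_W_iZ: "bdot (W_iZ W Z) (W_iZ W' Z') = of_real (W \<bullet> W' - Z \<bullet> Z')"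
  unfolding bdot_def sum_UNIV_Plus inner_vec_def by (simp add: sum_negf mult_ac flip: sum_distrib_left)

lemma block_mult:
  "block A B C D ** block A' B' C' D' =
   block (A ** A' + B ** C') (A ** B' + B ** D') (C ** A' + D ** C') (C ** B' + D ** D')"
  by (simp add: vec_eq_iff_Plus vec_eq_iff matrix_matrix_mult_def sum_UNIV_Plus)

lemma Imn_Imn: "Imn ** Imn = mat 1"
proof -
  have "block (mat 1) 0 0 (mat 1) = mat 1"
    by (simp add: vec_eq_iff_Plus mat_def)
  then show ?thesis by (simp add: Imn_def block_mult)
qed

lemma matrix_inv_Imn: "matrix_inv Imn = Imn"
  by (rule matrix_inv_eq[OF Imn_Imn])

lemma block_eta:
  "M = block (\<chi> i j. M $ Inl i $ Inl j) (\<chi> i j. M $ Inl i $ Inr j)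
         (\<chi> i j. M $ Inr i $ Inl j) (\<chi> i j. M $ Inr i $ Inr j)"
  by (simp add: vec_eq_iff_Plus)

lemma Imn_block_Imn: "Imn ** block A B C D ** Imn = block A (- B) (- C) D"
  by (simp add: Imn_def block_mult)

lemma Imn_conj_nth:
  fixes M :: "complex^('m::finite + 'n::finite)^('m + 'n)"
  shows "(Imn ** M ** Imn) $ Inl i $ Inl j = M $ Inl i $ Inl j"
  "(Imn ** M ** Imn) $ Inl i $ Inr l = - M $ Inl i $ Inr l"
  "(Imn ** M ** Imn) $ Inr k $ Inl j = - M $ Inr k $ Inl j"
  "(Imn ** M ** Imn) $ Inr k $ Inr l = M $ Inr k $ Inr l"
  using Imn_block_Imn[of "\<chi> i j. M $ Inl i $ Inl j" "\<chi> i j. M $ Inl i $ Inr j"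
      "\<chi> i j. M $ Inr i $ Inl j" "\<chi> i j. M $ Inr i $ Inr j"]
  by (simp_all add: block_eta[symmetric])

context
  fixes W :: "real^'m::finite" and Z :: "real^'n::finite"
  assumes nz: "W \<noteq> 0" and iso: "W \<bullet> W = Z \<bullet> Z"
begin

lemma snd_nz: "Z \<noteq> 0"
  using nz iso by (metis inner_eq_zero_iff)

text \<open>The normalising factor is the pairing of the vector with its conjugate, which gives
  idempotence; the mixed products vanish because both vectors are isotropic.\<close>

lemma line_proj_idem: "line_proj W Z ** line_proj W Z = line_proj W Z"
  and line_proj_orth: "line_proj W Z ** transpose (line_proj W Z) = 0" "transpose (line_proj W Z) ** line_proj W Z = 0"
  using snd_nz iso by (simp_all add: line_proj_def transpose_oprod oprod_oprod bdot_W_iZ)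

lemma line_proj_cnj: "map_matrix cnj (line_proj W Z) = transpose (line_proj W Z)"
  unfolding line_proj_def transpose_mscale transpose_oprod vec_eq_iff_Plus by (simp add: oprod_def)

text \<open>\<open>Imn\<close> sends \<open>W_iZ W Z\<close> to its complex conjugate, so
  conjugation exchanges the two vectors of the rank one matrix.\<close>

lemma line_proj_Imn: "Imn ** line_proj W Z ** Imn = transpose (line_proj W Z)"
  unfolding line_proj_def transpose_mscale transpose_oprod vec_eq_iff_Plus
  by (simp add: Imn_conj_nth oprod_def)

text \<open>The range condition leaves one unknown scalar \<open>d\<close> in
  \<open>R *v w = d *s ?v\<close>. Hermitian symmetry makes \<open>transpose R\<close> fix the
  conjugate vector \<open>?u\<close>, and pairing with \<open>?u\<close> determines
  \<open>d\<close>.\<close>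

lemma hermitian_projection_onto_line_proj_iff:
  "hermitian_projection_onto (complex_line (W_iZ W Z)) R \<longleftrightarrow> R = line_proj W Z"
proof
  let ?v = "W_iZ W Z" and ?u = "W_iZ W (- Z)" and ?c = "of_real (2 * (W \<bullet> W)) :: complex"
  have c: "?c \<noteq> 0" "bdot ?u ?v = ?c" using snd_nz iso by (simp_all add: bdot_W_iZ)
  have u: "?u = (\<chi> i. cnj (?v $ i))" by (simp add: vec_eq_iff_Plus)
  {
    assume R: "hermitian_projection_onto (complex_line ?v) R"
    then have RR: "R ** R = R" and herm: "map_matrix cnj (transpose R) = R"
      and ran: "range (\<lambda>v. R *v v) = complex_line ?v"
      by (auto simp: hermitian_projection_onto_def)
    have "?v \<in> complex_line ?v" by (auto simp: complex_line_def intro: range_eqI[of _ _ 1])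
    then obtain w where "?v = R *v w" using ran by blast
    then have Rv: "R *v ?v = ?v" by (metis RR matrix_vector_mul_assoc)
    have "transpose R *v ?u = (\<chi> i. cnj ((map_matrix cnj (transpose R) *v ?v) $ i))"
      by (simp add: u vec_eq_iff matrix_vector_mult_def del: transpose_matrix_vector)
    also have "\<dots> = ?u" unfolding herm Rv u ..
    finally have Ru: "transpose R *v ?u = ?u" .
    have "R *v w = line_proj W Z *v w" for w
    proof -
      obtain d where d: "R *v w = d *s ?v"
        using ran by (force simp: complex_line_def)
      have "bdot ?u w = bdot ?u (R *v w)"
        by (metis Ru bdot_transpose)
      also have "\<dots> = d * ?c"
        unfolding d c(2)[symmetric] by (simp add: bdot_def sum_distrib_left mult_ac)
      finally have "d = bdot ?u w / ?c" using c by simp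
      moreover have "line_proj W Z *v w = (inverse ?c * bdot ?u w) *s ?v"
        unfolding line_proj_def
        by (simp add: vec_eq_iff matrix_vector_mult_def oprod_def bdot_def sum_distrib_left mult_ac)
      ultimately show ?thesis using d by (simp add: field_simps)
    qed
    then show "R = line_proj W Z" by (simp add: matrix_eq)
  }
  assume R: "R = line_proj W Z"
  have "transpose (transpose (line_proj W Z)) = line_proj W Z" by simp
  then have herm: "map_matrix cnj (transpose R) = R"
    by (simp add: R map_matrix_cnj_simps line_proj_cnj del: transpose_transpose)
  have mv: "line_proj W Z *v w = (inverse ?c * bdot ?u w) *s ?v" for w
    unfolding line_proj_def
    by (simp add: vec_eq_iff matrix_vector_mult_def oprod_def bdot_def sum_distrib_left mult_ac)
  have "c *s ?v = line_proj W Z *v (c *s ?v)" for c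
  proof -
    have "bdot ?u (c *s ?v) = c * ?c"
      unfolding c(2)[symmetric] by (simp add: bdot_def sum_distrib_left mult_ac)
    then show ?thesis unfolding mv using c by simp
  qed
  then have "complex_line ?v \<subseteq> range (\<lambda>v. R *v v)"
    unfolding complex_line_def R by blast
  moreover have "range (\<lambda>v. R *v v) \<subseteq> complex_line ?v"
    unfolding complex_line_def R mv by blast
  ultimately have "range (\<lambda>v. R *v v) = complex_line ?v" by blast
  then show "hermitian_projection_onto (complex_line ?v) R"
    using herm line_proj_idem by (simp add: hermitian_projection_onto_def R)
qed

end

section \<open>Algebra of the simple element\<close>

text \<open>Since \<open>P ** Q = 0\<close>, the complements multiply to
  \<open>mat 1 - P - Q\<close>, with scalar \<open>r * r' = 1\<close>; the product becomes affine in
  \<open>P\<close> and \<open>Q\<close>, ready for partial fractions.\<close>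

lemma simple_factor_mult:
  fixes P Q :: "complex^'k^'k"
  assumes "P ** Q = 0" and r: "r * r' = 1"
  shows "(P + r \<cdot>\<^sub>m (mat 1 - P)) ** (Q + r' \<cdot>\<^sub>m (mat 1 - Q)) = mat 1 + (r' - 1) \<cdot>\<^sub>m P - (1 - r) \<cdot>\<^sub>m Q"
proof -
  have "(P + r \<cdot>\<^sub>m (mat 1 - P)) ** (Q + r' \<cdot>\<^sub>m (mat 1 - Q)) =
      r' \<cdot>\<^sub>m P + r \<cdot>\<^sub>m Q + (r * r') \<cdot>\<^sub>m (mat 1 - P - Q)"
    by (simp add: matrix_distrib assms(1)) (simp add: vec_eq_iff algebra_simps)
  then show ?thesis unfolding r by (simp add: vec_eq_iff algebra_simps)
qed

lemma g_map_eq: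
  fixes P :: "complex^'k^'k"
  assumes "P ** map_matrix cnj P = 0" and z: "z \<noteq> \<i> * of_real s" "z \<noteq> - \<i> * of_real s"
  shows "g_map s P z = mat 1 + (2 * (\<i> * of_real s) / (z - \<i> * of_real s)) \<cdot>\<^sub>m P
           - (2 * (\<i> * of_real s) / (z + \<i> * of_real s)) \<cdot>\<^sub>m map_matrix cnj P"
proof -
  define a where "a = \<i> * complex_of_real s"
  have nz: "z - a \<noteq> 0" "z + a \<noteq> 0" using z by (auto simp: a_def add_eq_0_iff2)
  then have r: "(z - a) / (z + a) * ((z + a) / (z - a)) = 1"
    and "(z + a) / (z - a) - 1 = 2 * a / (z - a)" "1 - (z - a) / (z + a) = 2 * a / (z + a)"
    by (simp, simp_all add: diff_divide_distrib[symmetric] divide_simps)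
  then show ?thesis
    unfolding g_map_def Let_def a_def[symmetric] simple_factor_mult[OF assms(1) r] by simp
qed

text \<open>The coefficients \<open>\<alpha> = 2a / (z + a)\<close> and \<open>\<beta> = 2a / (z - a)\<close> enter only through
  \<open>\<beta> - \<alpha> = \<alpha> \<beta>\<close>, \<open>\<alpha> z = 2a - \<alpha> a\<close> and \<open>\<beta> z = 2a + \<beta> a\<close>.\<close>

lemma simple_element_orthogonal:
  fixes P Q :: "complex^'k^'k"
  assumes "P ** P = P" "Q ** Q = Q" "P ** Q = 0" "Q ** P = 0" and "\<beta> - \<alpha> = \<alpha> * \<beta>"
  shows "(mat 1 + \<beta> \<cdot>\<^sub>m P - \<alpha> \<cdot>\<^sub>m Q) ** (mat 1 - \<alpha> \<cdot>\<^sub>m P + \<beta> \<cdot>\<^sub>m Q) = mat 1"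
proof -
  have "(mat 1 + \<beta> \<cdot>\<^sub>m P - \<alpha> \<cdot>\<^sub>m Q) ** (mat 1 - \<alpha> \<cdot>\<^sub>m P + \<beta> \<cdot>\<^sub>m Q) =
      mat 1 + (\<beta> - \<alpha> - \<alpha> * \<beta>) \<cdot>\<^sub>m (P + Q)"
    by (simp add: matrix_distrib assms(1-4)) (simp add: vec_eq_iff algebra_simps)
  then show ?thesis by (simp add: assms(5))
qed

text \<open>This is the gauge rule \<open>\<theta> h + dh = h \<theta>'\<close>, where
  \<open>h\<close> is the inverse simple element. The new form \<open>\<theta>'\<close> differs from
  \<open>\<theta>\<close> by a commutator with \<open>A\<close> that does not involve
  \<open>z\<close>.\<close>

lemma gauge_identity:
  fixes A B P Q :: "complex^'k^'k"
  assumes proj: "P ** P = P" "Q ** Q = Q" "P ** Q = 0" "Q ** P = 0" "P ** A ** Q = 0" "Q ** A ** P = 0"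
    and \<alpha>: "\<alpha> * z = 2 * a - \<alpha> * a" and \<beta>: "\<beta> * z = 2 * a + \<beta> * a"
    and dP: "dP = P ** B - B ** P + a \<cdot>\<^sub>m (A ** P + P ** A) - (2 * a) \<cdot>\<^sub>m (P ** A ** P)"
    and dQ: "dQ = Q ** B - B ** Q - a \<cdot>\<^sub>m (A ** Q + Q ** A) + (2 * a) \<cdot>\<^sub>m (Q ** A ** Q)"
    and h: "h = mat 1 - \<alpha> \<cdot>\<^sub>m P + \<beta> \<cdot>\<^sub>m Q"
  shows "(z \<cdot>\<^sub>m A + B) ** h + (\<beta> \<cdot>\<^sub>m dQ - \<alpha> \<cdot>\<^sub>m dP) =
         h ** (z \<cdot>\<^sub>m A + B + (2 * a) \<cdot>\<^sub>m ((P - Q) ** A - A ** (P - Q)))"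
proof -
  have proj_left: "P ** (P ** X) = P ** X" "Q ** (Q ** X) = Q ** X" "P ** (Q ** X) = 0"
    "Q ** (P ** X) = 0" "P ** (A ** Q) = 0" "Q ** (A ** P) = 0" for X
    using proj by (simp_all add: matrix_mul_assoc)
  \<comment> \<open>Read entrywise, each non-commuting product is just a complex number, so after
    expansion commutative algebra finishes from the relations on \<alpha> and \<beta>.\<close>
  have "((z \<cdot>\<^sub>m A + B) ** h + (\<beta> \<cdot>\<^sub>m dQ - \<alpha> \<cdot>\<^sub>m dP)) $ i $ j =
         (h ** (z \<cdot>\<^sub>m A + B + (2 * a) \<cdot>\<^sub>m ((P - Q) ** A - A ** (P - Q)))) $ i $ j" for i j
    unfolding dP dQ h
    by (simp add: matrix_distrib matrix_mul_assoc[symmetric] proj(1-4) proj_left)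
       (use \<alpha> \<beta> in algebra)
  then show ?thesis by (simp add: vec_eq_iff)
qed

text \<open>The right-hand side has no poles: it is the value of the dressed frame also at \<open>z = \<plusminus>a\<close>.\<close>

lemma dressing_remove_poles:
  fixes E :: "complex^'k^'k"
  assumes E: "E = Ea + (z - a) \<cdot>\<^sub>m F" "E = Eb + (z + a) \<cdot>\<^sub>m G"
    and F: "F = Fa + (z - a) \<cdot>\<^sub>m F2" and G: "G = Gb + (z + a) \<cdot>\<^sub>m G2"
    and at_a: "P ** Ea ** (mat 1 - p) = 0" "(mat 1 - Q) ** Ea ** q = 0" "P ** Ea ** q = 0" "P ** Fa ** q = 0"
    and at_b: "Q ** Eb ** (mat 1 - q) = 0" "(mat 1 - P) ** Eb ** p = 0" "Q ** Eb ** p = 0" "Q ** Gb ** p = 0"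
    and \<beta>: "\<beta> * (z - a) = 2 * a" and \<alpha>: "\<alpha> * (z + a) = 2 * a" and \<alpha>\<beta>: "\<beta> - \<alpha> = \<alpha> * \<beta>"
  shows "(mat 1 + \<beta> \<cdot>\<^sub>m P - \<alpha> \<cdot>\<^sub>m Q) ** E ** (mat 1 - \<alpha> \<cdot>\<^sub>m p + \<beta> \<cdot>\<^sub>m q) =
    E + (2 * a) \<cdot>\<^sub>m (P ** F ** (mat 1 - p) + (mat 1 - Q) ** F ** q) + (2 * a)\<^sup>2 \<cdot>\<^sub>m (P ** F2 ** q)
      - (2 * a) \<cdot>\<^sub>m (Q ** G ** (mat 1 - q) + (mat 1 - P) ** G ** p) + (2 * a)\<^sup>2 \<cdot>\<^sub>m (Q ** G2 ** p)"
proof -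
  \<comment> \<open>Partial fractions: \<open>\<alpha> * \<beta> = \<beta> - \<alpha>\<close>
    removes the mixed products, so the poles at \<open>a\<close> and \<open>- a\<close>
    separate.\<close>
  have "((mat 1 + \<beta> \<cdot>\<^sub>m P - \<alpha> \<cdot>\<^sub>m Q) ** E ** (mat 1 - \<alpha> \<cdot>\<^sub>m p + \<beta> \<cdot>\<^sub>m q)) $ i $ j =
    (E + \<beta> \<cdot>\<^sub>m (P ** E ** (mat 1 - p) + (mat 1 - Q) ** E ** q) + \<beta>\<^sup>2 \<cdot>\<^sub>m (P ** E ** q)
      - \<alpha> \<cdot>\<^sub>m (Q ** E ** (mat 1 - q) + (mat 1 - P) ** E ** p) + \<alpha>\<^sup>2 \<cdot>\<^sub>m (Q ** E ** p)) $ i $ j" for i j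
    by (simp add: matrix_distrib matrix_mul_assoc[symmetric]) (use \<alpha>\<beta> in algebra)
  then have *: "(mat 1 + \<beta> \<cdot>\<^sub>m P - \<alpha> \<cdot>\<^sub>m Q) ** E ** (mat 1 - \<alpha> \<cdot>\<^sub>m p + \<beta> \<cdot>\<^sub>m q) =
    E + \<beta> \<cdot>\<^sub>m (P ** E ** (mat 1 - p) + (mat 1 - Q) ** E ** q) + \<beta>\<^sup>2 \<cdot>\<^sub>m (P ** E ** q)
      - \<alpha> \<cdot>\<^sub>m (Q ** E ** (mat 1 - q) + (mat 1 - P) ** E ** p) + \<alpha>\<^sup>2 \<cdot>\<^sub>m (Q ** E ** p)"
    by (simp add: vec_eq_iff)
  have a1: "X ** E ** Y = (z - a) \<cdot>\<^sub>m (X ** F ** Y)" if "X ** Ea ** Y = 0" for X Y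
    using that by (simp add: E(1) matrix_add_ldistrib matrix_add_rdistrib)
  have b1: "X ** E ** Y = (z + a) \<cdot>\<^sub>m (X ** G ** Y)" if "X ** Eb ** Y = 0" for X Y
    using that by (simp add: E(2) matrix_add_ldistrib matrix_add_rdistrib)
  \<comment> \<open>Here the quotient vanishes at \<open>a\<close> too, which supplies the second
    factor \<open>z - a\<close> needed against \<open>\<beta>\<^sup>2\<close>.\<close>
  have a2: "P ** F ** q = (z - a) \<cdot>\<^sub>m (P ** F2 ** q)"
    by (subst F) (simp add: at_a matrix_add_ldistrib matrix_add_rdistrib)
  have b2: "Q ** G ** p = (z + a) \<cdot>\<^sub>m (Q ** G2 ** p)"
    by (subst G) (simp add: at_b matrix_add_ldistrib matrix_add_rdistrib)
  have "\<beta>\<^sup>2 * ((z - a) * (z - a)) = (2 * a)\<^sup>2" "\<alpha>\<^sup>2 * ((z + a) * (z + a)) = (2 * a)\<^sup>2"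
    unfolding \<alpha>[symmetric] by (simp_all add: \<beta>[unfolded \<alpha>[symmetric], symmetric] power2_eq_square mult_ac)
  then show ?thesis
    unfolding * a1[OF at_a(1)] a1[OF at_a(2)] a1[OF at_a(3)] b1[OF at_b(1)] b1[OF at_b(2)] b1[OF at_b(3)]
      a2 b2 mscale_distrib mscale_simps \<alpha> \<beta> by simp
qed

section \<open>The connection form\<close>

definition Amat :: "('n \<Rightarrow> 'm) \<Rightarrow> real^'n \<Rightarrow> complex^('m::finite + 'n::finite)^('m + 'n)" where
  "Amat \<iota> w = (\<Sum>i\<in>UNIV. w $ i *\<^sub>R block 0 (- Dmat \<iota> i) (transpose (Dmat \<iota> i)) 0)"

definition Vmat :: "real^'n^'m \<Rightarrow> complex^('m::finite + 'n::finite)^('m + 'n)" where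
  "Vmat X = block 0 (map_matrix of_real X) (- transpose (map_matrix of_real X)) 0"

definition Bmat :: "('n \<Rightarrow> 'm) \<Rightarrow> real^'n^'m \<Rightarrow> real^'n \<Rightarrow> complex^('m::finite + 'n::finite)^('m + 'n)" where
  "Bmat \<iota> X w = Amat \<iota> w ** Vmat X - Vmat X ** Amat \<iota> w"

lemma block_diff: "block A B C D - block A' B' C' D' =
    block (A - A') (B - B') (C - C') (D - (D' :: 'a::ab_group_add^'n^'n))"
  and block_minus: "- block A B C D = block (- A) (- B) (- C) (- D)"
  unfolding vec_eq_iff_Plus by simp_all

text \<open>The commutator of two block off-diagonal matrices is block diagonal; with
  \<open>Vmat\<close> its blocks are those of \<open>theta_coeff\<close>.\<close>

lemma theta_eq: "theta \<iota> \<xi> z x w = z \<cdot>\<^sub>m Amat \<iota> w + Bmat \<iota> (\<xi> x) w"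
proof -
  let ?A = "\<lambda>i. block 0 (- Dmat \<iota> i) (transpose (Dmat \<iota> i)) 0" and ?V = "Vmat (\<xi> x)"
  have "theta_coeff \<iota> (map_matrix of_real (\<xi> x)) z i = z \<cdot>\<^sub>m ?A i + (?A i ** ?V - ?V ** ?A i)" for i
    unfolding theta_coeff_def Let_def Vmat_def block_mult by (simp add: block_diff)
  then show ?thesis
    unfolding theta_def Amat_def Bmat_def
    by (simp add: bounded_bilinear.sum_left[OF bounded_bilinear_matrix_mult]
        bounded_bilinear.sum_right[OF bounded_bilinear_matrix_mult]
        bounded_bilinear.sum_right[OF bounded_bilinear_mscale]
        bounded_bilinear.scaleR_left[OF bounded_bilinear_matrix_mult]
        bounded_bilinear.scaleR_right[OF bounded_bilinear_matrix_mult]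
        bounded_bilinear.scaleR_right[OF bounded_bilinear_mscale]
        sum.distrib sum_subtractf scaleR_add_right scaleR_diff_right)
qed

lemma transpose_scaleR_sum:
  "transpose (\<Sum>i\<in>I. c i *\<^sub>R M i) = (\<Sum>i\<in>I. c i *\<^sub>R transpose (M i :: complex^'n^'m))"
  by (simp add: linear_sum[OF bounded_linear.linear[OF bounded_linear_transpose]]
      linear_cmul[OF bounded_linear.linear[OF bounded_linear_transpose]])

lemma transpose_block: "transpose (block A B C D) = block (transpose A) (transpose C) (transpose B) (transpose D)"
  unfolding vec_eq_iff_Plus by (simp add: vec_eq_iff_Plus vec_eq_iff transpose_def)

lemma transpose_zero [simp]: "transpose 0 = 0"
  by (simp add: vec_eq_iff transpose_def)

lemma transpose_Amat: "transpose (Amat \<iota> w) = - Amat \<iota> w"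
proof -
  have "transpose (block 0 (- Dmat \<iota> i) (transpose (Dmat \<iota> i)) 0) =
      - block 0 (- Dmat \<iota> i) (transpose (Dmat \<iota> i)) 0" for i
    unfolding transpose_block transpose_minus by (simp add: block_minus)
  then show ?thesis
    by (simp add: Amat_def transpose_scaleR_sum sum_negf)
qed

lemma transpose_Vmat: "transpose (Vmat X) = - Vmat X"
  unfolding Vmat_def transpose_block transpose_minus by (simp add: block_minus)

lemma transpose_Bmat: "transpose (Bmat \<iota> X w) = - Bmat \<iota> X w"
  by (simp add: Bmat_def transpose_diff matrix_transpose_mul transpose_Amat transpose_Vmat)

lemma transpose_theta: "transpose (theta \<iota> \<xi> z x w) = - theta \<iota> \<xi> z x w"
  by (simp add: theta_eq transpose_add transpose_Amat transpose_Bmat mscale_distrib)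

lemma Vmat_add: "Vmat (X + Y) = Vmat X + Vmat Y"
  and Vmat_diff: "Vmat (X - Y) = Vmat X - Vmat Y"
  and Vmat_scaleR: "Vmat (c *\<^sub>R X) = c *\<^sub>R Vmat X"
  unfolding Vmat_def vec_eq_iff_Plus
  by (simp_all add: vec_eq_iff transpose_def scaleR_conv_of_real[where 'a=complex])

text \<open>For diagonal \<open>Y\<close> both \<open>D\<^sub>i Y\<^sup>t\<close> and \<open>D\<^sub>i\<^sup>t Y\<close> are symmetric.\<close>

lemma Bmat_off_diag:
  fixes \<iota> :: "'n::finite \<Rightarrow> 'm::finite"
  assumes "inj \<iota>"
  shows "Bmat \<iota> (off_diag \<iota> X) w = Bmat \<iota> X w"
proof -
  define Y where "Y = X - off_diag \<iota> X"
  let ?C = "map_matrix complex_of_real Y"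
  have Y: "Y $ k $ j = 0" if "k \<noteq> \<iota> j" for k j
    using that by (simp add: Y_def off_diag_def)
  \<comment> \<open>By injectivity of \<iota>, row \<open>\<iota> i\<close> of the diagonal matrix
    \<open>Y\<close> can be non-zero only in column \<open>i\<close>.\<close>
  have Y_row: "Y $ \<iota> i $ l = 0" if "l \<noteq> i" for i l
    using that Y injD[OF assms] by metis
  have "(Dmat \<iota> i ** transpose ?C) $ k $ l = (if k = \<iota> i then Y $ l $ i else 0)"
    "(?C ** transpose (Dmat \<iota> i)) $ k $ l = (if l = \<iota> i then Y $ k $ i else 0)" for i k l
    by (auto simp: matrix_matrix_mult_def Dmat_def transpose_def if_distrib[of "\<lambda>x. x * _"]
        if_distrib[of "\<lambda>x. _ * x"] cong: if_cong)
  then have c1: "Dmat \<iota> i ** transpose ?C = ?C ** transpose (Dmat \<iota> i)" for i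
    unfolding vec_eq_iff using Y by auto
  have "(transpose (Dmat \<iota> i) ** ?C) $ k $ l = (if k = i then Y $ \<iota> i $ l else 0)"
    "(transpose ?C ** Dmat \<iota> i) $ k $ l = (if l = i then Y $ \<iota> i $ k else 0)" for i k l
    by (auto simp: matrix_matrix_mult_def Dmat_def transpose_def if_distrib[of "\<lambda>x. x * _"]
        if_distrib[of "\<lambda>x. _ * x"] cong: if_cong)
  then have c2: "transpose (Dmat \<iota> i) ** ?C = transpose ?C ** Dmat \<iota> i" for i
    unfolding vec_eq_iff using Y_row by simp
  have "block 0 (- Dmat \<iota> i) (transpose (Dmat \<iota> i)) 0 ** Vmat Y =
      Vmat Y ** block 0 (- Dmat \<iota> i) (transpose (Dmat \<iota> i)) 0" for i
    unfolding Vmat_def block_mult by (simp add: c1 c2)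
  then have "Bmat \<iota> Y w = 0"
    unfolding Amat_def Bmat_def
    by (simp add: bounded_bilinear.sum_left[OF bounded_bilinear_matrix_mult]
        bounded_bilinear.sum_right[OF bounded_bilinear_matrix_mult]
        bounded_bilinear.scaleR_left[OF bounded_bilinear_matrix_mult]
        bounded_bilinear.scaleR_right[OF bounded_bilinear_matrix_mult])
  moreover have "Bmat \<iota> Y w = Bmat \<iota> X w - Bmat \<iota> (off_diag \<iota> X) w"
    unfolding Y_def Bmat_def by (simp add: Vmat_diff matrix_distrib)
  ultimately show ?thesis by simp
qed

text \<open>Equality of the norms turns their product into \<open>W \<bullet> W\<close>, which
  avoids square roots when smoothness of the new potential is shown.\<close>

lemma outer_normalized:
  fixes W :: "real^'m::finite" and Z :: "real^'n::finite"
  assumes "W \<bullet> W = Z \<bullet> Z"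
  shows "outer (W /\<^sub>R norm W) (Z /\<^sub>R norm Z) = inverse (W \<bullet> W) *\<^sub>R outer W Z"
proof -
  have "norm W = norm Z" using assms by (simp add: norm_eq_sqrt_inner)
  then have "inverse (norm W) * inverse (norm Z) = inverse (W \<bullet> W)"
    by (simp add: power2_norm_eq_inner[symmetric] power2_eq_square)
  then show ?thesis by (simp add: outer_def vec_eq_iff)
qed

text \<open>The diagonal blocks of \<open>line_proj W Z\<close> are symmetric and cancel. In the
  other two the factor \<open>\<i>\<close> meets the one inside \<open>W_iZ\<close>, which leaves
  the real correction of the potential.\<close>

lemma line_proj_diff:
  fixes W :: "real^'m::finite" and Z :: "real^'n::finite"
  assumes "W \<bullet> W = Z \<bullet> Z"
  shows "(2 * (\<i> * of_real s)) \<cdot>\<^sub>m (line_proj W Z - transpose (line_proj W Z)) =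
      Vmat ((2 * s) *\<^sub>R outer (W /\<^sub>R norm W) (Z /\<^sub>R norm Z))"
  unfolding outer_normalized[OF assms] line_proj_def transpose_mscale transpose_oprod Vmat_def vec_eq_iff_Plus
  by (simp add: vec_eq_iff oprod_def transpose_def outer_def algebra_simps)

section \<open>Dressing\<close>

lemma bounded_linear_map_matrix_cnj: "bounded_linear (map_matrix cnj :: complex^'n^'m \<Rightarrow> _)"
  unfolding linear_conv_bounded_linear[symmetric]
  by (auto intro!: linearI simp: vec_eq_iff)

lemma bounded_linear_Vmat: "bounded_linear Vmat"
  unfolding linear_conv_bounded_linear[symmetric]
  by (auto intro!: linearI simp: Vmat_add Vmat_scaleR)

lemma smooth_theta:
  assumes "smooth \<xi>"
  shows "smooth (\<lambda>x. theta \<iota> \<xi> z x w)" "smooth (\<lambda>z. theta \<iota> \<xi> z x w)"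
  unfolding theta_eq Bmat_def
  by (intro smooth_add smooth_diff smooth_matrix_mult smooth_mscale smooth_const smooth_ident
      smooth_bounded_linear_compose[OF bounded_linear_Vmat] assms)+

text \<open>If \<open>dE = E \<theta>\<close>, symmetry of the second derivatives of \<open>E\<close> says \<open>E (d\<theta> + \<theta> \<and> \<theta>) = 0\<close>.\<close>

lemma flat_of_has_derivative:
  fixes E :: "'a::euclidean_space \<Rightarrow> complex^'k^'k"
  assumes E: "smooth E" and \<theta>: "\<And>w. smooth (\<lambda>x. \<theta> x w)"
    and dE: "\<And>x. (E has_derivative (\<lambda>w. E x ** \<theta> x w)) (at x)"
    and inv: "\<And>x. E' x ** E x = mat 1"
  shows "flat \<theta>"
  unfolding flat_def
proof (intro allI)
  fix x u v
  have fE: "frechet_derivative E (at y) w = E y ** \<theta> y w" for y w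
    using frechet_derivative_at[OF dE] by metis
  have d: "frechet_derivative (\<lambda>y. E y ** \<theta> y w) (at x) w' =
      E x ** frechet_derivative (\<lambda>y. \<theta> y w) (at x) w' + E x ** \<theta> x w' ** \<theta> x w" for w w'
    by (rule frechet_derivative_at[THEN sym, THEN fun_cong])
       (rule bounded_bilinear.FDERIV[OF bounded_bilinear_matrix_mult dE smooth_has_derivative[OF \<theta>]])
  have "frechet_derivative (\<lambda>y. E y ** \<theta> y v) (at x) u = frechet_derivative (\<lambda>y. E y ** \<theta> y u) (at x) v"
    using frechet_derivative_commute[OF E, of v x u] unfolding fE .
  then have "E x ** (ext_deriv \<theta> x u v + wedge \<theta> \<theta> x u v) = 0"
    unfolding d ext_deriv_def wedge_def matrix_add_ldistrib matrix_diff_ldistrib matrix_mul_assoc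
    by (simp only: add_diff_add[symmetric] right_minus_eq)
  then have "E' x ** E x ** (ext_deriv \<theta> x u v + wedge \<theta> \<theta> x u v) = 0"
    by (simp flip: matrix_mul_assoc)
  then show "ext_deriv \<theta> x u v + wedge \<theta> \<theta> x u v = 0" by (simp add: inv)
qed

text \<open>Here \<open>F b = E'(b)\<close>, so this is \<open>E E\<^sup>t = 1\<close> differentiated at \<open>b\<close>.\<close>

lemma orthogonal_difference_quotient_skew:
  fixes E F :: "complex \<Rightarrow> complex^'k^'k"
  assumes orth: "\<And>z. E z ** transpose (E z) = mat 1" and F: "smooth F"
    and E: "\<And>z. E z = E b + (z - b) \<cdot>\<^sub>m F z"
  shows "transpose (F b ** transpose (E b)) = - (F b ** transpose (E b))"
proof -
  let ?S = "\<lambda>z. E b ** transpose (F z) + F z ** transpose (E b) + (z - b) \<cdot>\<^sub>m (F z ** transpose (F z))"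
  have "?S z = 0" if "z \<noteq> b" for z
  proof -
    have "E z ** transpose (E z) = E b ** transpose (E b) + (z - b) \<cdot>\<^sub>m ?S z"
      by (subst (1 2) E[of z])
         (simp add: transpose_add matrix_add_ldistrib matrix_add_rdistrib mscale_distrib algebra_simps)
    then have "(z - b) \<cdot>\<^sub>m ?S z = 0" by (simp add: orth)
    then have "inverse (z - b) \<cdot>\<^sub>m ((z - b) \<cdot>\<^sub>m ?S z) = 0" by (simp only: mscale_simps)
    then show ?thesis using that by (simp only: mscale_simps) simp
  qed
  moreover have "smooth ?S"
    by (intro smooth_add smooth_matrix_mult smooth_mscale smooth_diff smooth_const smooth_ident F
        smooth_bounded_linear_compose[OF bounded_linear_transpose])
  \<comment> \<open>At \<open>b\<close> the term with \<open>z - b\<close> drops out; what remains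
    is \<open>F b ** transpose (E b)\<close> plus its transpose.\<close>
  ultimately have "?S b = 0"
    using smooth_eq_off_two_points[of ?S "\<lambda>_. 0" b b b] by simp
  then show ?thesis
    by (simp add: matrix_transpose_mul eq_neg_iff_add_eq_0)
qed

lemma matrix_vector_minus: "(- A) *v x = - (A *v (x :: complex^'n))"
  by (simp add: vec_eq_iff matrix_vector_mult_def sum_negf)

text \<open>\<open>M\<close> and \<open>N\<close> stand for the value and the
  \<open>z\<close>-derivative of the frame at a pole. Orthogonality gives
  \<open>M *v ut = u\<close>, hence the first two identities; the third holds as \<open>u\<close> is
  isotropic, the fourth as \<open>N ** transpose M\<close> is skew. They are the vanishing
  conditions of \<open>dressing_remove_poles\<close>.\<close>

lemma pole_cancellation:
  fixes M N :: "complex^'k^'k"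
  assumes orth: "M ** transpose M = mat 1" and skew: "transpose (N ** transpose M) = - (N ** transpose M)"
    and u: "bdot u u = 0" and k: "bdot u v = k" "k \<noteq> 0"
    and ut: "ut = transpose M *v u" and c: "bdot ut vt = c" "c \<noteq> 0"
  shows "inverse k \<cdot>\<^sub>m oprod v u ** M ** (mat 1 - inverse c \<cdot>\<^sub>m oprod vt ut) = 0"
    and "(mat 1 - inverse k \<cdot>\<^sub>m oprod u v) ** M ** (inverse c \<cdot>\<^sub>m oprod ut vt) = 0"
    and "inverse k \<cdot>\<^sub>m oprod v u ** M ** (inverse c \<cdot>\<^sub>m oprod ut vt) = 0"
    and "inverse k \<cdot>\<^sub>m oprod v u ** N ** (inverse c \<cdot>\<^sub>m oprod ut vt) = 0"
proof -
  have Mut: "M *v ut = u" unfolding ut matrix_vector_mul_assoc orth by simp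
  have uM: "oprod v u ** M = oprod v ut" by (simp only: oprod_matrix ut)
  have Nut: "bdot u (N *v ut) = 0"
    unfolding ut matrix_vector_mul_assoc by (rule bdot_skew[OF skew])
  show "inverse k \<cdot>\<^sub>m oprod v u ** M ** (mat 1 - inverse c \<cdot>\<^sub>m oprod vt ut) = 0"
    using c by (simp add: matrix_diff_ldistrib uM oprod_oprod mult.left_commute[of "inverse c"])
  show "(mat 1 - inverse k \<cdot>\<^sub>m oprod u v) ** M ** (inverse c \<cdot>\<^sub>m oprod ut vt) = 0"
  proof -
    have "M ** (inverse c \<cdot>\<^sub>m oprod ut vt) = inverse c \<cdot>\<^sub>m oprod u vt"
      by (simp add: matrix_oprod Mut)
    then show ?thesis
      unfolding matrix_mul_assoc[symmetric]
      using k by (simp add: matrix_diff_rdistrib oprod_oprod bdot_commute[of v u])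
  qed
  show "inverse k \<cdot>\<^sub>m oprod v u ** M ** (inverse c \<cdot>\<^sub>m oprod ut vt) = 0"
    by (simp add: matrix_mul_assoc[symmetric] matrix_oprod[of M] Mut oprod_oprod u)
  show "inverse k \<cdot>\<^sub>m oprod v u ** N ** (inverse c \<cdot>\<^sub>m oprod ut vt) = 0"
    by (simp add: matrix_mul_assoc[symmetric] matrix_oprod[of N] oprod_oprod Nut)
qed

text \<open>\<open>g_map\<close> in partial fractions, with the transpose of \<open>P\<close> for
  its conjugate; the two agree on \<open>line_proj\<close> for vectors of equal norm. At
  \<open>z = \<plusminus>a\<close> the value is only an artefact of division by zero.\<close>

definition simple_elt :: "complex \<Rightarrow> complex^'k^'k \<Rightarrow> complex \<Rightarrow> complex^'k^'k" where
  "simple_elt a P z = mat 1 + (2 * a / (z - a)) \<cdot>\<^sub>m P - (2 * a / (z + a)) \<cdot>\<^sub>m transpose P"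

lemma transpose_simple_elt:
  "transpose (simple_elt a P z) = mat 1 - (2 * a / (z + a)) \<cdot>\<^sub>m P + (2 * a / (z - a)) \<cdot>\<^sub>m transpose P"
  by (simp add: simple_elt_def transpose_add transpose_diff)

lemma coefficient_identities:
  fixes a z :: complex
  assumes "z \<noteq> a" "z \<noteq> - a"
  shows "2 * a / (z - a) - 2 * a / (z + a) = 2 * a / (z + a) * (2 * a / (z - a))"
    and "2 * a / (z + a) * z = 2 * a - 2 * a / (z + a) * a"
    and "2 * a / (z - a) * z = 2 * a + 2 * a / (z - a) * a"
    and "2 * a / (z - a) * (z - a) = 2 * a"
    and "2 * a / (z + a) * (z + a) = 2 * a"
proof -
  have nz: "z - a \<noteq> 0" "z + a \<noteq> 0" using assms by (auto simp: add_eq_0_iff2)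
  show "2 * a / (z - a) * (z - a) = 2 * a" "2 * a / (z + a) * (z + a) = 2 * a" using nz by auto
  then show "2 * a / (z + a) * z = 2 * a - 2 * a / (z + a) * a" "2 * a / (z - a) * z = 2 * a + 2 * a / (z - a) * a"
    by (simp_all only: algebra_simps)
  have "2 * a / (z - a) - 2 * a / (z + a) = (2 * a * (z + a) - 2 * a * (z - a)) / ((z - a) * (z + a))"
    using nz by (rule diff_frac_eq)
  also have "2 * a * (z + a) - 2 * a * (z - a) = 2 * a * (2 * a)" by algebra
  finally show "2 * a / (z - a) - 2 * a / (z + a) = 2 * a / (z + a) * (2 * a / (z - a))"
    by (simp add: mult.commute)
qed

context
  fixes W :: "real^'m::finite" and Z :: "real^'n::finite"
  assumes nz: "W \<noteq> 0" and iso: "W \<bullet> W = Z \<bullet> Z"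
begin

lemma line_proj_transpose_idem: "transpose (line_proj W Z) ** transpose (line_proj W Z) = transpose (line_proj W Z)"
  by (metis line_proj_idem[OF nz iso] matrix_transpose_mul)

lemma simple_elt_line_proj_orthogonal:
  assumes "z \<noteq> a" "z \<noteq> - a"
  shows "simple_elt a (line_proj W Z) z ** transpose (simple_elt a (line_proj W Z) z) = mat 1"
  unfolding transpose_simple_elt unfolding simple_elt_def
  by (intro simple_element_orthogonal line_proj_idem line_proj_transpose_idem line_proj_orth nz iso coefficient_identities assms)

lemma simple_elt_line_proj_cnj: "cnj a = - a \<Longrightarrow> map_matrix cnj (simple_elt a (line_proj W Z) (cnj z)) = simple_elt a (line_proj W Z) z"
  by (simp add: simple_elt_def map_matrix_cnj_simps line_proj_cnj[OF nz iso]) (simp add: vec_eq_iff)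

text \<open>Replacing \<open>z\<close> by \<open>- z\<close> exchanges the two coefficients up to
  sign, while conjugation by \<open>Imn\<close> exchanges the projection with its transpose.\<close>

lemma simple_elt_line_proj_Imn: "Imn ** simple_elt a (line_proj W Z) z ** Imn = simple_elt a (line_proj W Z) (- z)"
proof -
  have "Imn ** transpose (line_proj W Z) ** Imn = Imn ** (Imn ** line_proj W Z ** Imn) ** Imn"
    by (simp only: line_proj_Imn[OF nz iso])
  also have "\<dots> = (Imn ** Imn) ** line_proj W Z ** (Imn ** Imn)" by (simp only: matrix_mul_assoc)
  finally have t: "Imn ** transpose (line_proj W Z) ** Imn = line_proj W Z" by (simp add: Imn_Imn)
  have "- z - a = - (z + a)" "- z + a = - (z - a)" by simp_all
  then have "2 * a / (- z - a) = - (2 * a / (z + a))" "2 * a / (- z + a) = - (2 * a / (z - a))"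
    by (simp_all only: divide_minus_right)
  then show ?thesis
    unfolding simple_elt_def
    by (simp add: matrix_distrib matrix_add_rdistrib matrix_diff_rdistrib Imn_Imn t line_proj_Imn[OF nz iso])
       (simp add: vec_eq_iff)
qed

lemma g_map_line_proj:
  assumes "z \<noteq> \<i> * of_real s" "z \<noteq> - \<i> * of_real s"
  shows "g_map s (line_proj W Z) z = simple_elt (\<i> * of_real s) (line_proj W Z) z"
  using g_map_eq[OF _ assms, of "line_proj W Z"] line_proj_orth[OF nz iso] by (simp add: line_proj_cnj[OF nz iso] simple_elt_def)

end

lemma bounded_bilinear_outer: "bounded_bilinear (outer :: real^'m \<Rightarrow> real^'n \<Rightarrow> _)"
  unfolding bilinear_conv_bounded_bilinear[symmetric] bilinear_def
  by (auto intro!: linearI simp: vec_eq_iff outer_def algebra_simps)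

lemma mscale_mult_vector: "(k \<cdot>\<^sub>m M) *v v = k *s (M *v v)"
  by (simp add: vec_eq_iff matrix_vector_mult_def sum_distrib_left mult_ac)

lemma bdot_vector_scalar_right: "bdot v (k *s w) = k * bdot v w"
  by (simp add: bdot_def sum_distrib_left mult_ac)

lemma bounded_linear_off_diag: "bounded_linear (off_diag \<iota>)"
  unfolding linear_conv_bounded_linear[symmetric]
  by (auto intro!: linearI simp: vec_eq_iff off_diag_def)

lemma vec_cnj_W_iZ: "(\<chi> r. cnj (W_iZ W Z $ r)) = W_iZ W (- Z)"
  unfolding vec_eq_iff_Plus by simp

lemma Imn_W_iZ: "Imn *v W_iZ W Z = W_iZ W (- Z)"
  unfolding vec_eq_iff_Plus
  by (simp add: Imn_def matrix_vector_mult_def sum_UNIV_Plus mat_def sum_negf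
      if_distrib[of "\<lambda>x. x * _"] cong: if_cong)

lemma Imn_mult_nth: "(Imn *v x) $ Inl i = x $ Inl i" "(Imn *v x) $ Inr j = - x $ Inr j"
  by (simp_all add: Imn_def matrix_vector_mult_def sum_UNIV_Plus mat_def sum_negf
      if_distrib[of "\<lambda>x. x * _"] cong: if_cong)

lemma transpose_Imn: "transpose Imn = Imn"
  by (simp add: Imn_def transpose_block transpose_minus)

section \<open>The dressed line and its derivative\<close>

locale dressing =
  fixes \<iota> :: "'n::finite \<Rightarrow> 'm::finite"
    and \<xi> :: "real^'n \<Rightarrow> real^'n^'m"
    and E :: "real^'n \<Rightarrow> complex \<Rightarrow> complex^('m + 'n)^('m + 'n)"
    and s :: real
    and W :: "real^'m" and Z :: "real^'n"
  assumes inj: "inj \<iota>"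
    and solution: "Gmn_solution \<iota> \<xi>"
    and frame: "Gmn_frame \<iota> \<xi> E"
    and holomorphic: "holomorphic_in_param E"
    and norm_W: "norm W = 1" and norm_Z: "norm Z = 1"
begin

definition "a = \<i> * complex_of_real s"

lemma cnj_a: "cnj a = - a"
  by (simp add: a_def)

lemma W_nz: "W \<noteq> 0" and W_W: "W \<bullet> W = 1" and Z_Z: "Z \<bullet> Z = 1"
  using norm_W norm_Z by (auto simp: norm_eq_1)

lemma W_iso: "W \<bullet> W = Z \<bullet> Z"
  by (simp add: W_W Z_Z)

lemma smooth_\<xi>: "smooth \<xi>" and diag_\<xi>: "\<xi> x $ \<iota> i $ i = 0"
  using solution by (auto simp: Gmn_solution_def)

lemma smooth_E: "smooth (\<lambda>(x, z). E x z)"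
  and E_cnj: "map_matrix cnj (E x (cnj z)) = E x z"
  and E_Imn: "Imn ** E x z ** Imn = E x (- z)"
  and E_orthogonal: "E x z ** transpose (E x z) = mat 1"
  using frame by (auto simp: Gmn_frame_def Gmn_reality_def matrix_inv_Imn)

lemma has_derivative_E: "((\<lambda>y. E y z) has_derivative (\<lambda>w. E x z ** theta \<iota> \<xi> z x w)) (at x)"
proof -
  let ?D = "\<lambda>w. frechet_derivative (\<lambda>y. E y z) (at x) w"
  have "matrix_inv (E x z) = transpose (E x z)" by (rule matrix_inv_eq[OF E_orthogonal])
  moreover have "matrix_inv (E x z) ** ?D w = theta \<iota> \<xi> z x w" for w
    using frame by (auto simp: Gmn_frame_def)
  ultimately have "transpose (E x z) ** ?D w = theta \<iota> \<xi> z x w" for w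
    by simp
  then have "E x z ** theta \<iota> \<xi> z x w = E x z ** (transpose (E x z) ** ?D w)" for w by simp
  then have "?D = (\<lambda>w. E x z ** theta \<iota> \<xi> z x w)"
    by (simp add: matrix_mul_assoc E_orthogonal)
  then show ?thesis using smooth_has_derivative[OF smooth_slice(1)[OF smooth_E], of z x] by simp
qed

text \<open>By orthogonality of \<open>E\<close> the transpose is the inverse, so this is the
  dressed vector. Its conjugate \<open>ut\<close> is written with \<open>E x a\<close> so that the
  frame equation differentiates it directly.\<close>

definition "vt x = transpose (E x (- a)) *v W_iZ W Z"
definition "ut x = transpose (E x a) *v W_iZ W (- Z)"
definition "Wt x = (\<chi> i. Re (vt x $ Inl i))"
definition "Zt x = (\<chi> j. Im (vt x $ Inr j))"

lemma ut_conv_cnj: "ut x = (\<chi> r. cnj (vt x $ r))"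
proof -
  have "E x a = map_matrix cnj (E x (- a))" using E_cnj[of x a] by (simp add: cnj_a)
  then show ?thesis
    by (simp add: ut_def vt_def vec_cnj_W_iZ[symmetric] vec_eq_iff matrix_vector_mult_def
        transpose_def del: transpose_matrix_vector)
qed

lemma ut_conv_Imn: "ut x = Imn *v vt x"
proof -
  have "E x a = Imn ** E x (- a) ** Imn" using E_Imn[of x "- a"] by simp
  then have "transpose (E x a) = Imn ** transpose (E x (- a)) ** Imn"
    by (simp add: matrix_transpose_mul transpose_Imn matrix_mul_assoc)
  then have "ut x = Imn *v (transpose (E x (- a)) *v (Imn *v W_iZ W (- Z)))"
    by (simp add: ut_def matrix_vector_mul_assoc matrix_mul_assoc del: transpose_matrix_vector)
  then show ?thesis by (simp add: vt_def Imn_W_iZ del: transpose_matrix_vector)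
qed

text \<open>Together the two reality conditions say that the conjugate of \<open>vt x\<close> is
  \<open>Imn *v vt x\<close>: the upper entries are real and the lower ones imaginary.\<close>

lemma vt_eq: "vt x = W_iZ (Wt x) (Zt x)"
proof -
  have "cnj (vt x $ r) = (Imn *v vt x) $ r" for r
    using ut_conv_cnj[of x] ut_conv_Imn[of x] by (simp add: vec_eq_iff)
  from this[of "Inl _"] this[of "Inr _"]
  show ?thesis
    unfolding vec_eq_iff_Plus by (simp add: Imn_mult_nth Wt_def Zt_def complex_eq_iff)
qed

lemma ut_eq: "ut x = W_iZ (Wt x) (- Zt x)"
  by (simp add: ut_conv_Imn vt_eq Imn_W_iZ)

text \<open>The orthogonal matrix \<open>E x (- a)\<close> preserves \<open>bdot\<close>, and the
  original vector is isotropic.\<close>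

lemma Wt_iso: "Wt x \<bullet> Wt x = Zt x \<bullet> Zt x"
proof -
  have "bdot (vt x) (vt x) = bdot (W_iZ W Z) (W_iZ W Z)"
    unfolding vt_def bdot_transpose matrix_vector_mul_assoc E_orthogonal by simp
  then show ?thesis by (simp add: vt_eq bdot_W_iZ W_iso)
qed

lemma Wt_nz: "Wt x \<noteq> 0"
proof
  assume 0: "Wt x = 0"
  then have "Zt x = 0" using Wt_iso[of x] by simp
  then have "vt x = 0" using 0 unfolding vt_eq vec_eq_iff_Plus by simp
  then have "E x (- a) *v (transpose (E x (- a)) *v W_iZ W Z) = 0" by (simp add: vt_def)
  then have "W_iZ W Z = 0" unfolding matrix_vector_mul_assoc E_orthogonal by simp
  then show False using W_nz by (simp add: vec_eq_iff_Plus vec_eq_iff)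
qed

lemma Zt_nz: "Zt x \<noteq> 0"
  using snd_nz[OF Wt_nz Wt_iso] .

text \<open>The squared Hermitian norm of \<open>vt x\<close>, since \<open>ut x\<close> is the
  conjugate vector.\<close>

definition "c x = bdot (ut x) (vt x)"

lemma c_eq: "c x = of_real (2 * (Wt x \<bullet> Wt x))"
  by (simp add: c_def ut_eq vt_eq bdot_W_iZ Wt_iso)

lemma c_nz: "c x \<noteq> 0"
  unfolding c_eq using Wt_nz by simp

abbreviation "P0 \<equiv> line_proj W Z"
abbreviation "P x \<equiv> line_proj (Wt x) (Zt x)"
abbreviation "Q x \<equiv> transpose (P x)"

lemma P_eq: "P x = inverse (c x) \<cdot>\<^sub>m oprod (vt x) (ut x)"
  by (simp only: line_proj_def c_eq ut_eq vt_eq)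

lemmas P_proj = line_proj_idem[OF Wt_nz Wt_iso] line_proj_transpose_idem[OF Wt_nz Wt_iso] line_proj_orth[OF Wt_nz Wt_iso]

lemma has_derivative_vt: "(vt has_derivative (\<lambda>w. - (theta \<iota> \<xi> (- a) x w *v vt x))) (at x)"
  and has_derivative_ut: "(ut has_derivative (\<lambda>w. - (theta \<iota> \<xi> a x w *v ut x))) (at x)"
proof -
  have "((\<lambda>y. transpose (E y z) *v v) has_derivative
      (\<lambda>w. - (theta \<iota> \<xi> z x w *v (transpose (E x z) *v v)))) (at x)" for z v
  proof -
    have "bounded_linear (\<lambda>M. transpose M *v v :: complex^('m + 'n))"
      using bounded_linear_compose[OF bounded_bilinear.bounded_linear_left[OF
            bounded_bilinear_matrix_vector_mult] bounded_linear_transpose] .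
    from bounded_linear.has_derivative[OF this has_derivative_E] show ?thesis
      by (simp add: matrix_transpose_mul transpose_theta matrix_vector_minus matrix_vector_mul_assoc[symmetric]
          del: transpose_matrix_vector)
  qed
  from this[of "- a"] this[of a] show "(vt has_derivative (\<lambda>w. - (theta \<iota> \<xi> (- a) x w *v vt x))) (at x)"
    "(ut has_derivative (\<lambda>w. - (theta \<iota> \<xi> a x w *v ut x))) (at x)"
    unfolding vt_def ut_def .
qed

abbreviation "A \<equiv> Amat \<iota>"
abbreviation "B x w \<equiv> Bmat \<iota> (\<xi> x) w"

definition "dP x w = P x ** B x w - B x w ** P x + a \<cdot>\<^sub>m (A w ** P x + P x ** A w)
  - (2 * a) \<cdot>\<^sub>m (P x ** A w ** P x)"

text \<open>Quotient rule for \<open>P_eq\<close>: the two vectors contribute the terms linear in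
  \<open>P x\<close>, and the denominator \<open>c\<close> contributes the quadratic term.\<close>

lemma has_derivative_P: "(P has_derivative dP x) (at x)"
proof -
  let ?k = "inverse (c x)" and ?O = "oprod (vt x) (ut x)"
  define dc where "dc w = 2 * a * bdot (ut x) (A w *v vt x)" for w
  have "(c has_derivative (\<lambda>w. bdot (ut x) (- (theta \<iota> \<xi> (- a) x w *v vt x))
      + bdot (- (theta \<iota> \<xi> a x w *v ut x)) (vt x))) (at x)"
    unfolding c_def[abs_def]
    by (rule bounded_bilinear.FDERIV[OF bounded_bilinear_bdot has_derivative_ut has_derivative_vt])
  moreover have "bdot (ut x) (- (theta \<iota> \<xi> (- a) x w *v vt x)) + bdot (- (theta \<iota> \<xi> a x w *v ut x)) (vt x) = dc w" for w
  proof -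
    have "bdot (- (theta \<iota> \<xi> a x w *v ut x)) (vt x) = bdot (ut x) (theta \<iota> \<xi> a x w *v vt x)"
      unfolding bdot_transpose[symmetric] transpose_theta matrix_vector_minus ..
    \<comment> \<open>The part \<open>B x w\<close> is independent of the spectral parameter and
      cancels, so the derivative of \<open>c\<close> involves \<open>A w\<close> only.\<close>
    moreover have "theta \<iota> \<xi> a x w - theta \<iota> \<xi> (- a) x w = (2 * a) \<cdot>\<^sub>m A w"
      unfolding theta_eq by (simp add: vec_eq_iff)
    then have "theta \<iota> \<xi> a x w *v vt x - theta \<iota> \<xi> (- a) x w *v vt x = (2 * a) *s (A w *v vt x)"
      by (simp only: matrix_vector_mult_diff_rdistrib[symmetric] mscale_mult_vector)
    then have "bdot (ut x) (theta \<iota> \<xi> a x w *v vt x) - bdot (ut x) (theta \<iota> \<xi> (- a) x w *v vt x) = dc w"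
      unfolding dc_def
      by (simp only: bounded_bilinear.diff_right[OF bounded_bilinear_bdot, symmetric] bdot_vector_scalar_right)
    ultimately show ?thesis
      by (simp add: bounded_bilinear.minus_right[OF bounded_bilinear_bdot])
  qed
  ultimately have dc: "(c has_derivative dc) (at x)" by (simp add: fun_eq_iff[symmetric])
  have "((\<lambda>y. inverse (c y) \<cdot>\<^sub>m oprod (vt y) (ut y)) has_derivative
      (\<lambda>w. ?k \<cdot>\<^sub>m (oprod (vt x) (- (theta \<iota> \<xi> a x w *v ut x)) + oprod (- (theta \<iota> \<xi> (- a) x w *v vt x)) (ut x))
        + (- (?k * dc w * ?k)) \<cdot>\<^sub>m ?O)) (at x)"
    by (intro bounded_bilinear.FDERIV[OF bounded_bilinear_mscale]
        bounded_bilinear.FDERIV[OF bounded_bilinear_oprod] has_derivative_vt has_derivative_ut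
        Deriv.has_derivative_inverse dc c_nz)
  moreover have "?k \<cdot>\<^sub>m (oprod (vt x) (- (theta \<iota> \<xi> a x w *v ut x)) + oprod (- (theta \<iota> \<xi> (- a) x w *v vt x)) (ut x))
        + (- (?k * dc w * ?k)) \<cdot>\<^sub>m ?O = dP x w" for w
  proof -
    have "oprod (vt x) (- (theta \<iota> \<xi> a x w *v ut x)) = ?O ** theta \<iota> \<xi> a x w"
      "oprod (- (theta \<iota> \<xi> (- a) x w *v vt x)) (ut x) = - (theta \<iota> \<xi> (- a) x w ** ?O)"
      unfolding oprod_matrix transpose_theta matrix_vector_minus by (simp_all add: matrix_oprod oprod_minus)
    moreover have "P x ** A w ** P x = (?k * ?k * bdot (ut x) (A w *v vt x)) \<cdot>\<^sub>m ?O"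
      unfolding P_eq by (simp add: matrix_mul_assoc[symmetric] matrix_oprod[of "A w"] oprod_oprod mult_ac)
    ultimately show ?thesis
      unfolding dP_def dc_def theta_eq
      by (simp add: P_eq matrix_add_ldistrib matrix_add_rdistrib) (simp add: vec_eq_iff algebra_simps)
  qed
  ultimately show ?thesis unfolding P_eq[abs_def] by (simp add: fun_eq_iff[symmetric])
qed

lemma transpose_dP: "transpose (dP x w) = transpose (P x) ** B x w - B x w ** transpose (P x)
   - a \<cdot>\<^sub>m (A w ** transpose (P x) + transpose (P x) ** A w)
   + (2 * a) \<cdot>\<^sub>m (transpose (P x) ** A w ** transpose (P x))"
  by (simp add: dP_def transpose_add transpose_diff matrix_transpose_mul transpose_Amat transpose_Bmat
      mscale_distrib matrix_mul_assoc)

text \<open>The scalar in the middle pairs a vector with its own image under the skew matrix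
  \<open>A w\<close>.\<close>

lemma P_A_orth: "P x ** A w ** transpose (P x) = 0" "transpose (P x) ** A w ** P x = 0"
  by (simp_all add: P_eq transpose_oprod matrix_mul_assoc[symmetric] matrix_oprod[of "A w"] oprod_oprod
      bdot_skew[OF transpose_Amat])

definition "\<xi>t x = \<xi> x - (2 * s) *\<^sub>R
  off_diag \<iota> (outer (Wt x /\<^sub>R norm (Wt x)) (Zt x /\<^sub>R norm (Zt x)))"

text \<open>\<open>off_diag\<close> leaves \<open>Bmat\<close> unchanged, and
  \<open>line_proj_diff\<close> turns the rank one correction into a commutator of
  \<open>A w\<close> with \<open>P x - Q x\<close>.\<close>

lemma theta_\<xi>t: "theta \<iota> \<xi>t z x w =
    z \<cdot>\<^sub>m A w + B x w + (2 * a) \<cdot>\<^sub>m ((P x - transpose (P x)) ** A w - A w ** (P x - transpose (P x)))"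
proof -
  let ?Y = "(2 * s) *\<^sub>R outer (Wt x /\<^sub>R norm (Wt x)) (Zt x /\<^sub>R norm (Zt x))"
  have "\<xi>t x = \<xi> x - off_diag \<iota> ?Y"
    by (simp add: \<xi>t_def vec_eq_iff off_diag_def)
  then have "Bmat \<iota> (\<xi>t x) w = B x w - Bmat \<iota> (off_diag \<iota> ?Y) w"
    by (simp add: Bmat_def Vmat_diff matrix_diff_ldistrib matrix_diff_rdistrib)
  also have "\<dots> = B x w - Bmat \<iota> ?Y w" by (simp only: Bmat_off_diag[OF inj])
  also have "Bmat \<iota> ?Y w = (2 * a) \<cdot>\<^sub>m (A w ** (P x - transpose (P x)) - (P x - transpose (P x)) ** A w)"
    unfolding Bmat_def line_proj_diff[OF Wt_iso, symmetric] a_def[symmetric]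
    by (simp add: mscale_distrib matrix_diff_ldistrib matrix_diff_rdistrib)
  finally show ?thesis
    unfolding theta_eq by (simp add: mscale_distrib)
qed

lemma smooth_vt: "smooth vt" and smooth_ut: "smooth ut"
proof -
  have "smooth (\<lambda>x. transpose (E x z) *v v)" for z v
    by (rule smooth_bounded_bilinear[OF bounded_bilinear_matrix_vector_mult
          smooth_bounded_linear_compose[OF bounded_linear_transpose smooth_slice(1)[OF smooth_E]] smooth_const])
  then show "smooth vt" "smooth ut" unfolding vt_def ut_def by blast+
qed

lemma smooth_Wt: "smooth Wt" and smooth_Zt: "smooth Zt"
  using smooth_vt unfolding Wt_def Zt_def smooth_vec_iff
  by (auto intro: smooth_bounded_linear_compose[OF bounded_linear_Re] smooth_bounded_linear_compose[OF bounded_linear_Im])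

lemma smooth_inverse_Wt: "smooth (\<lambda>x. inverse (Wt x \<bullet> Wt x))"
  using Wt_nz smooth_bounded_bilinear[OF bounded_bilinear_inner smooth_Wt smooth_Wt]
  by (intro smooth_inverse) auto

lemma smooth_P: "smooth P"
proof -
  have inv: "inverse (c x) = of_real (inverse 2 * inverse (Wt x \<bullet> Wt x))" for x
    by (simp add: c_eq)
  then show ?thesis
    unfolding P_eq inv
    by (intro smooth_mscale smooth_bounded_bilinear[OF bounded_bilinear_oprod] smooth_vt smooth_ut
        smooth_bounded_linear_compose[OF bounded_linear_of_real]
        smooth_bounded_linear_compose[OF bounded_linear_mult_right] smooth_inverse_Wt)
qed

lemma smooth_\<xi>t: "smooth \<xi>t"
  unfolding \<xi>t_def[abs_def] outer_normalized[OF Wt_iso]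
  by (intro smooth_diff smooth_\<xi> smooth_scaleR smooth_const
      smooth_bounded_bilinear[OF bounded_bilinear_outer] smooth_Wt smooth_Zt
      smooth_inverse_Wt smooth_bounded_linear_compose[OF bounded_linear_off_diag])

section \<open>The dressed frame and its extension to the poles\<close>

definition "dressed x z = simple_elt a P0 z ** E x z ** transpose (simple_elt a (P x) z)"

text \<open>The left factor is constant in \<open>x\<close>, so everything rests on
  \<open>gauge_identity\<close> for the right factor.\<close>

lemma has_derivative_dressed:
  assumes z: "z \<noteq> a" "z \<noteq> - a"
  shows "((\<lambda>y. dressed y z) has_derivative (\<lambda>w. dressed x z ** theta \<iota> \<xi>t z x w)) (at x)"
proof -
  let ?\<alpha> = "2 * a / (z + a)" and ?\<beta> = "2 * a / (z - a)"
  let ?h = "\<lambda>y. transpose (simple_elt a (P y) z)"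
  let ?dh = "\<lambda>w. ?\<beta> \<cdot>\<^sub>m transpose (dP x w) - ?\<alpha> \<cdot>\<^sub>m dP x w"
  have "(?h has_derivative ?dh) (at x)"
  proof -
    have "((\<lambda>y. mat 1 - ?\<alpha> \<cdot>\<^sub>m P y + ?\<beta> \<cdot>\<^sub>m transpose (P y)) has_derivative
        (\<lambda>w. 0 - ?\<alpha> \<cdot>\<^sub>m dP x w + ?\<beta> \<cdot>\<^sub>m transpose (dP x w))) (at x)"
      by (intro has_derivative_add has_derivative_diff has_derivative_const has_derivative_P
          bounded_linear.has_derivative[OF bounded_bilinear.bounded_linear_right[OF bounded_bilinear_mscale]]
          bounded_linear.has_derivative[OF bounded_linear_transpose])
    then show ?thesis unfolding transpose_simple_elt by simp
  qed
  from bounded_bilinear.FDERIV[OF bounded_bilinear_matrix_mult bounded_linear.has_derivative[OF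
        bounded_bilinear.bounded_linear_right[OF bounded_bilinear_matrix_mult] has_derivative_E] this]
  have "((\<lambda>y. dressed y z) has_derivative (\<lambda>w. simple_elt a P0 z ** E x z ** ?dh w
      + simple_elt a P0 z ** (E x z ** theta \<iota> \<xi> z x w) ** ?h x)) (at x)"
    unfolding dressed_def .
  moreover have "simple_elt a P0 z ** E x z ** ?dh w + simple_elt a P0 z ** (E x z ** theta \<iota> \<xi> z x w) ** ?h x =
      dressed x z ** theta \<iota> \<xi>t z x w" for w
  proof -
    have "theta \<iota> \<xi> z x w ** ?h x + ?dh w = ?h x ** theta \<iota> \<xi>t z x w"
      unfolding theta_eq[of \<iota> \<xi>] theta_\<xi>t
      by (rule gauge_identity[OF P_proj P_A_orth coefficient_identities(2,3)[OF z] dP_def transpose_dP transpose_simple_elt])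
    then have "simple_elt a P0 z ** E x z ** (theta \<iota> \<xi> z x w ** ?h x + ?dh w) = dressed x z ** theta \<iota> \<xi>t z x w"
      by (simp add: dressed_def matrix_mul_assoc)
    then show ?thesis by (simp add: matrix_add_ldistrib matrix_mul_assoc add.commute)
  qed
  ultimately show ?thesis by simp
qed

lemma dressed_cnj: "map_matrix cnj (dressed x (cnj z)) = dressed x z"
  unfolding dressed_def map_matrix_cnj_simps simple_elt_line_proj_cnj[OF W_nz W_iso cnj_a] simple_elt_line_proj_cnj[OF Wt_nz Wt_iso cnj_a]
    E_cnj ..

lemma dressed_Imn: "Imn ** dressed x z ** Imn = dressed x (- z)"
proof -
  have h: "Imn ** transpose (simple_elt a (P x) z) ** Imn = transpose (simple_elt a (P x) (- z))"
    unfolding simple_elt_line_proj_Imn[OF Wt_nz Wt_iso, symmetric]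
    by (simp add: matrix_transpose_mul transpose_Imn matrix_mul_assoc)
  \<comment> \<open>Copies of \<open>Imn ** Imn = mat 1\<close> are inserted between the factors, so
    that each is conjugated separately.\<close>
  have "dressed x (- z) = Imn ** simple_elt a P0 z ** (Imn ** Imn) ** E x z ** (Imn ** Imn) **
      transpose (simple_elt a (P x) z) ** Imn"
    unfolding dressed_def simple_elt_line_proj_Imn[OF W_nz W_iso, symmetric] h[symmetric] E_Imn[symmetric]
    by (simp only: matrix_mul_assoc)
  then show ?thesis by (simp add: Imn_Imn dressed_def matrix_mul_assoc)
qed

lemma dressed_orthogonal:
  assumes z: "z \<noteq> a" "z \<noteq> - a"
  shows "dressed x z ** transpose (dressed x z) = mat 1"
proof -
  have h: "transpose (simple_elt a (P x) z) ** simple_elt a (P x) z = mat 1"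
    using simple_elt_line_proj_orthogonal[OF Wt_nz Wt_iso z] matrix_left_right_inverse by metis
  have "dressed x z ** transpose (dressed x z) = simple_elt a P0 z ** (E x z **
     (transpose (simple_elt a (P x) z) ** simple_elt a (P x) z) ** transpose (E x z)) ** transpose (simple_elt a P0 z)"
    by (simp add: dressed_def matrix_transpose_mul matrix_mul_assoc)
  then show ?thesis by (simp add: h E_orthogonal simple_elt_line_proj_orthogonal[OF W_nz W_iso z])
qed

text \<open>The pole-free expression of \<open>dressing_remove_poles\<close> serves as the
  extension; it inherits smoothness and holomorphy from the difference quotients.\<close>

lemma dressed_extends:
  "\<exists>Et. smooth (\<lambda>(x, z). Et x z) \<and> holomorphic_in_param Et \<and>
    (\<forall>x z. z \<noteq> a \<longrightarrow> z \<noteq> - a \<longrightarrow> Et x z = dressed x z)"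
proof -
  \<comment> \<open>\<open>F\<close> and \<open>F2\<close> are first and second difference quotients
    at \<open>a\<close>, \<open>G\<close> and \<open>G2\<close> at \<open>- a\<close>. Second ones
    occur because the left and right factors together can produce a double pole.\<close>
  obtain F where F: "smooth (\<lambda>(x, z). F x z)" "holomorphic_in_param F"
    "\<And>x z. E x z = E x a + (z - a) \<cdot>\<^sub>m F x z"
    using smooth_holomorphic_in_param_divide[OF smooth_E holomorphic] by blast
  obtain F2 where F2: "smooth (\<lambda>(x, z). F2 x z)" "holomorphic_in_param F2"
    "\<And>x z. F x z = F x a + (z - a) \<cdot>\<^sub>m F2 x z"
    using smooth_holomorphic_in_param_divide[OF F(1,2)] by blast
  obtain G where G: "smooth (\<lambda>(x, z). G x z)" "holomorphic_in_param G"
    "\<And>x z. E x z = E x (- a) + (z - (- a)) \<cdot>\<^sub>m G x z"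
    using smooth_holomorphic_in_param_divide[OF smooth_E holomorphic] by blast
  obtain G2 where G2: "smooth (\<lambda>(x, z). G2 x z)" "holomorphic_in_param G2"
    "\<And>x z. G x z = G x (- a) + (z - (- a)) \<cdot>\<^sub>m G2 x z"
    using smooth_holomorphic_in_param_divide[OF G(1,2)] by blast
  let ?Q0 = "transpose P0"
  define Et where "Et x z = E x z + (2 * a) \<cdot>\<^sub>m (P0 ** F x z ** (mat 1 - P x) + (mat 1 - ?Q0) ** F x z ** Q x)
     + (2 * a)\<^sup>2 \<cdot>\<^sub>m (P0 ** F2 x z ** Q x)
     - (2 * a) \<cdot>\<^sub>m (?Q0 ** G x z ** (mat 1 - Q x) + (mat 1 - P0) ** G x z ** P x)
     + (2 * a)\<^sup>2 \<cdot>\<^sub>m (?Q0 ** G2 x z ** P x)" for x z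
  show ?thesis
  proof (intro exI conjI allI impI)
    show "smooth (\<lambda>(x, z). Et x z)"
      unfolding Et_def case_prod_unfold
      by (intro smooth_add smooth_diff smooth_mscale smooth_matrix_mult smooth_const
          smooth_bounded_linear_compose[OF bounded_linear_transpose]
          smooth_compose[OF smooth_P] smooth_bounded_linear[OF bounded_linear_fst]
          smooth_E[unfolded case_prod_unfold] F(1)[unfolded case_prod_unfold] F2(1)[unfolded case_prod_unfold]
          G(1)[unfolded case_prod_unfold] G2(1)[unfolded case_prod_unfold])
    show "holomorphic_in_param Et"
      unfolding Et_def[abs_def]
      by (intro holomorphic_in_param_add holomorphic_in_param_diff holomorphic_in_param_mscale
          holomorphic_in_param_mult holomorphic_in_param_const holomorphic F(2) F2(2) G(2) G2(2))
    show "Et x z = dressed x z" if z: "z \<noteq> a" "z \<noteq> - a" for x z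
    proof -
      let ?v = "W_iZ W Z" and ?u = "W_iZ W (- Z)"
      have uu: "bdot ?u ?u = 0" "bdot ?v ?v = 0" and uv: "bdot ?u ?v = 2" "bdot ?v ?u = 2"
        by (simp_all add: bdot_W_iZ W_W Z_Z)
      have c: "bdot (ut x) (vt x) = c x" "bdot (vt x) (ut x) = c x"
        by (simp_all add: c_def bdot_commute)
      have P0: "P0 = inverse 2 \<cdot>\<^sub>m oprod ?v ?u" "?Q0 = inverse 2 \<cdot>\<^sub>m oprod ?u ?v"
        by (simp_all add: line_proj_def W_W transpose_oprod)
      have Px: "P x = inverse (c x) \<cdot>\<^sub>m oprod (vt x) (ut x)" "Q x = inverse (c x) \<cdot>\<^sub>m oprod (ut x) (vt x)"
        by (simp_all add: P_eq transpose_oprod)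
      have skew: "transpose (F x a ** transpose (E x a)) = - (F x a ** transpose (E x a))"
        "transpose (G x (- a) ** transpose (E x (- a))) = - (G x (- a) ** transpose (E x (- a)))"
        by (rule orthogonal_difference_quotient_skew[OF E_orthogonal smooth_slice(2)[OF F(1)] F(3)])
           (rule orthogonal_difference_quotient_skew[OF E_orthogonal smooth_slice(2)[OF G(1)] G(3)])
      \<comment> \<open>At \<open>- a\<close> the conjugate vectors change places, and with them
        each projection and its transpose.\<close>
      note at_a = pole_cancellation[OF E_orthogonal skew(1) uu(1) uv(1) _ ut_def c(1) c_nz, folded P0 Px, simplified]
      note at_b = pole_cancellation[OF E_orthogonal skew(2) uu(2) uv(2) _ vt_def c(2) c_nz, folded P0 Px, simplified]
      have "simple_elt a P0 z ** E x z ** transpose (simple_elt a (P x) z) = Et x z"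
        unfolding transpose_simple_elt unfolding simple_elt_def Et_def
        by (rule dressing_remove_poles[OF F(3) G(3)[unfolded diff_minus_eq_add] F2(3)
              G2(3)[unfolded diff_minus_eq_add] at_a at_b coefficient_identities(4,5,1)[OF z]])
      then show ?thesis by (simp add: dressed_def)
    qed
  qed
qed

end

section \<open>Continuation of the identities to the poles and conclusion\<close>

theorem theorem9p3:
  fixes \<iota> :: "'n::finite \<Rightarrow> 'm::finite"
    and \<xi> :: "real^'n \<Rightarrow> real^'n^'m"
    and E :: "real^'n \<Rightarrow> complex \<Rightarrow> complex^('m + 'n)^('m + 'n)"
    and s :: real
    and W :: "real^'m" and Z :: "real^'n"
    and \<pi> :: "complex^('m + 'n)^('m + 'n)"
  assumes "inj \<iota>"
    and "Gmn_solution \<iota> \<xi>"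
    and "Gmn_frame \<iota> \<xi> E"
    and "holomorphic_in_param E"
    and "s \<noteq> 0"
    and "norm W = 1" and "norm Z = 1"
    and "hermitian_projection_onto (complex_line (W_iZ W Z)) \<pi>"
  shows "\<exists>(Wt :: real^'n \<Rightarrow> real^'m) (Zt :: real^'n \<Rightarrow> real^'n)
          (\<pi>t :: real^'n \<Rightarrow> complex^('m + 'n)^('m + 'n))
          (\<xi>t :: real^'n \<Rightarrow> real^'n^'m)
          (Et :: real^'n \<Rightarrow> complex \<Rightarrow> complex^('m + 'n)^('m + 'n)).
      (\<forall>x. W_iZ (Wt x) (Zt x) = matrix_inv (E x (- \<i> * of_real s)) *v W_iZ W Z) \<and>
      (\<forall>x. Wt x \<noteq> 0 \<and> Zt x \<noteq> 0) \<and>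
      (\<forall>x. hermitian_projection_onto (complex_line (W_iZ (Wt x) (Zt x))) (\<pi>t x)) \<and>
      (\<forall>x. \<xi>t x = \<xi> x - (2 * s) *\<^sub>R
              off_diag \<iota> (outer (Wt x /\<^sub>R norm (Wt x)) (Zt x /\<^sub>R norm (Zt x)))) \<and>
      (\<forall>x z. z \<noteq> \<i> * of_real s \<and> z \<noteq> - \<i> * of_real s \<longrightarrow>
              Et x z = g_map s \<pi> z ** E x z ** matrix_inv (g_map s (\<pi>t x) z)) \<and>
      Gmn_solution \<iota> \<xi>t \<and>
      Gmn_frame \<iota> \<xi>t Et \<and>
      holomorphic_in_param Et"
proof -
  interpret dressing \<iota> \<xi> E s W Z
    using assms by unfold_locales
  have \<pi>: "\<pi> = P0"
    using assms(8) hermitian_projection_onto_line_proj_iff[OF W_nz W_iso] by simp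
  obtain Et where Et: "smooth (\<lambda>(x, z). Et x z)" and hol: "holomorphic_in_param Et"
    and Et_eq: "\<And>x z. z \<noteq> a \<Longrightarrow> z \<noteq> - a \<Longrightarrow> Et x z = dressed x z"
    using dressed_extends by blast
  have Et_z: "smooth (Et x)" "smooth (\<lambda>z. Et x (cnj z))" "smooth (\<lambda>z. Et x (- z))" for x
    using smooth_compose[OF smooth_slice(2)[OF Et] smooth_bounded_linear[OF bounded_linear_cnj]]
      smooth_compose[OF smooth_slice(2)[OF Et] smooth_minus[OF smooth_ident]] smooth_slice(2)[OF Et]
    by blast+
  \<comment> \<open>Both sides are smooth in \<open>z\<close>, so agreement off the poles is enough;
    as \<open>a\<close> is imaginary, conjugation permutes the poles.\<close>
  have Et_cnj: "map_matrix cnj (Et x (cnj z)) = Et x z" for x z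
  proof (rule smooth_eq_off_two_points[where b=a and c="- a" and z=z])
    fix z assume z: "z \<noteq> a" "z \<noteq> - a"
    then have "cnj z \<noteq> a" "cnj z \<noteq> - a" using cnj_a by (metis complex_cnj_cnj complex_cnj_minus minus_minus)+
    then show "map_matrix cnj (Et x (cnj z)) = Et x z" using z by (simp add: Et_eq dressed_cnj)
  qed (intro smooth_bounded_linear_compose[OF bounded_linear_map_matrix_cnj] Et_z)+
  have Et_Imn: "Imn ** Et x z ** Imn = Et x (- z)" for x z
  proof (rule smooth_eq_off_two_points[where b=a and c="- a" and z=z])
    fix z assume z: "z \<noteq> a" "z \<noteq> - a"
    then have "- z \<noteq> a" "- z \<noteq> - a" by (metis minus_minus)+
    then show "Imn ** Et x z ** Imn = Et x (- z)" using z by (simp add: Et_eq dressed_Imn)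
  qed (intro smooth_matrix_mult smooth_const Et_z)+
  have Et_orth: "Et x z ** transpose (Et x z) = mat 1" for x z
  proof (rule smooth_eq_off_two_points[where b=a and c="- a" and z=z])
    show "Et x z ** transpose (Et x z) = mat 1" if "z \<noteq> a" "z \<noteq> - a" for z
      using that by (simp add: Et_eq dressed_orthogonal)
  qed (intro smooth_matrix_mult smooth_bounded_linear_compose[OF bounded_linear_transpose] smooth_const Et_z)+
  have Et_orth': "transpose (Et x z) ** Et x z = mat 1" for x z
    using Et_orth matrix_left_right_inverse by metis
  have Et_deriv: "((\<lambda>y. Et y z) has_derivative (\<lambda>w. Et x z ** theta \<iota> \<xi>t z x w)) (at x)" for x z
  proof -
    \<comment> \<open>The derivative in \<open>x\<close> is taken from the joint derivative, so that
      it is smooth in \<open>z\<close> and the density argument applies.\<close>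
    let ?D = "\<lambda>z w. frechet_derivative (\<lambda>(x, z). Et x z) (at (x, z)) (w, 0)"
    have "?D z w = Et x z ** theta \<iota> \<xi>t z x w" for w
    proof (rule smooth_eq_off_two_points[where b=a and c="- a" and z=z])
      show "smooth (\<lambda>z. ?D z w)"
        by (rule smooth_compose[OF smooth_frechet_derivative[OF Et] smooth_Pair[OF smooth_const smooth_ident]])
      show "smooth (\<lambda>z. Et x z ** theta \<iota> \<xi>t z x w)"
        by (intro smooth_matrix_mult Et_z smooth_theta smooth_\<xi>t)
      fix z assume z: "z \<noteq> a" "z \<noteq> - a"
      then have "((\<lambda>y. Et y z) has_derivative (\<lambda>w. Et x z ** theta \<iota> \<xi>t z x w)) (at x)"
        using has_derivative_dressed[OF z, of x] by (simp add: Et_eq)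
      from has_derivative_unique[OF has_derivative_slice[OF Et] this]
      show "?D z w = Et x z ** theta \<iota> \<xi>t z x w" by metis
    qed
    then show ?thesis using has_derivative_slice[OF Et, of z x] by simp
  qed
  have "Gmn_frame \<iota> \<xi>t Et"
    unfolding Gmn_frame_def Gmn_reality_def
  proof (intro conjI allI)
    show "invertible (Et x z)" for x z
      unfolding invertible_def using Et_orth Et_orth' by blast
    show "matrix_inv (Et x z) ** frechet_derivative (\<lambda>y. Et y z) (at x) w = theta \<iota> \<xi>t z x w" for x z w
      unfolding matrix_inv_eq[OF Et_orth] frechet_derivative_at[OF Et_deriv, symmetric]
      by (simp add: matrix_mul_assoc Et_orth')
  qed (simp_all add: Et Et_cnj Et_Imn Et_orth matrix_inv_Imn)
  moreover have "Gmn_solution \<iota> \<xi>t"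
    unfolding Gmn_solution_def
  proof (intro conjI allI)
    show "\<xi>t x $ \<iota> i $ i = 0" for x i by (simp add: \<xi>t_def off_diag_def diag_\<xi>)
    \<comment> \<open>Flatness is the integrability condition of the frame equation, now available
      for every \<open>z\<close>, the poles included.\<close>
    show "flat (theta \<iota> \<xi>t z)" for z
      by (rule flat_of_has_derivative[OF smooth_slice(1)[OF Et] smooth_theta(1)[OF smooth_\<xi>t] Et_deriv Et_orth'])
  qed (rule smooth_\<xi>t)
  moreover have "W_iZ (Wt x) (Zt x) = matrix_inv (E x (- \<i> * of_real s)) *v W_iZ W Z" for x
    unfolding matrix_inv_eq[OF E_orthogonal] vt_eq[symmetric] vt_def by (simp add: a_def)
  moreover have "Et x z = g_map s \<pi> z ** E x z ** matrix_inv (g_map s (P x) z)"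
    if z: "z \<noteq> \<i> * of_real s" "z \<noteq> - \<i> * of_real s" for x z
  proof -
    have "z \<noteq> a" "z \<noteq> - a" using z by (simp_all add: a_def)
    then show ?thesis
      unfolding \<pi> g_map_line_proj[OF W_nz W_iso z] g_map_line_proj[OF Wt_nz Wt_iso z] a_def[symmetric]
      by (simp add: Et_eq dressed_def matrix_inv_eq[OF simple_elt_line_proj_orthogonal[OF Wt_nz Wt_iso]])
  qed
  ultimately show ?thesis
    using hol Wt_nz Zt_nz hermitian_projection_onto_line_proj_iff[OF Wt_nz Wt_iso] \<xi>t_def
    by (intro exI[of _ Wt] exI[of _ Zt] exI[of _ P] exI[of _ \<xi>t] exI[of _ Et]) blast
qed

end
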